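(* Let $(W,S)$ be a finite Coxeter system. Then $\Phi:\Sigma W\to\mathbb{Q}_{class}W$ is surjective if and only if $W$ is a direct product of symmetric groups (as a Coxeter group, i.e. every irreducible component of $(W,S)$ is of type $A_n$ for some $n$).
   Context: $\ell$ is the length function. For $I\subset S$, $W_I$ is the subgroup generated by $I$, $X_I=\{w\in W:\ell(ws)>\ell(w)\ \forall s\in I\}$, and $x_I=\sum_{w\in X_I}w\in\mathbb{Q}W$. The Solomon descent algebra $\Sigma W$ is the $\mathbb{Q}$-span of $\{x_I\}_{I\subset S}$ in $\mathbb{Q}W$; it is a subalgebra and the $x_I$ form a basis of it. $\mathbb{Q}_{class}W$ is the $\mathbb{Q}$-algebra of $\mathbb{Q}$-valued class functions on $W$. $\Phi$ is the $\mathbb{Q}$-linear map (the Solomon homomorphism, an algebra homomorphism) with $\Phi(x_I)=1_{W_I}^W$, the character of $W$ induced from the trivial character of $W_I$. *)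

theory Defs
  imports "HOL-Algebra.Algebra" "HOL-Library.Indicator_Function"
begin

section \<open>Coxeter systems\<close>

definition word_prod :: "('a, 'b) monoid_scheme \<Rightarrow> 'a list \<Rightarrow> 'a" where
  "word_prod W ws = foldr (\<otimes>\<^bsub>W\<^esub>) ws \<one>\<^bsub>W\<^esub>"

text \<open>
  The congruence on words over \<open>S\<close> generated by the Coxeter relations
  \<open>(s t)^m(s,t) = 1\<close>, where \<open>m(s,t)\<close> is the order of \<open>s t\<close> in \<open>W\<close>.
  The library order of an element of infinite order is \<open>0\<close>, which gives the trivial relation
  for \<open>m(s,t) = \<infinity>\<close>, as desired.
  For an involution \<open>s\<close>, the case \<open>s = t\<close> is the relation \<open>s s = 1\<close>, so that the monoid
  presented by these relations is the group they present and no formal inverses are needed.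
\<close>

inductive coxeter_cong ::
    "('a, 'b) monoid_scheme \<Rightarrow> 'a set \<Rightarrow> 'a list \<Rightarrow> 'a list \<Rightarrow> bool"
  for W S where
  rel: "\<lbrakk>s \<in> S; t \<in> S; u \<in> lists S; v \<in> lists S\<rbrakk> \<Longrightarrow>
    coxeter_cong W S (u @ concat (replicate (group.ord W (s \<otimes>\<^bsub>W\<^esub> t)) [s, t]) @ v) (u @ v)"
| refl: "u \<in> lists S \<Longrightarrow> coxeter_cong W S u u"
| sym: "coxeter_cong W S u v \<Longrightarrow> coxeter_cong W S v u"
| trans: "\<lbrakk>coxeter_cong W S u v; coxeter_cong W S v w\<rbrakk> \<Longrightarrow> coxeter_cong W S u w"

text \<open>\<open>W\<close> is presented by the involutions \<open>S\<close> subject to the Coxeter relations.\<close>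

locale coxeter_system = group W for W (structure) +
  fixes S :: "'a set"
  assumes gens_closed: "S \<subseteq> carrier W"
    and gens_involutions: "s \<in> S \<Longrightarrow> group.ord W s = 2"
    and gens_generate: "generate W S = carrier W"
    and presentation: "\<lbrakk>u \<in> lists S; v \<in> lists S\<rbrakk> \<Longrightarrow>
      word_prod W u = word_prod W v \<longleftrightarrow> coxeter_cong W S u v"

definition cox_length :: "('a, 'b) monoid_scheme \<Rightarrow> 'a set \<Rightarrow> 'a \<Rightarrow> nat" where
  "cox_length W S w = (LEAST n. \<exists>ws \<in> lists S. length ws = n \<and> word_prod W ws = w)"

definition coxeter_graph :: "('a, 'b) monoid_scheme \<Rightarrow> 'a set \<Rightarrow> 'a rel" where
  "coxeter_graph W S =
    {(s, t). s \<in> S \<and> t \<in> S \<and> s \<noteq> t \<and> group.ord W (s \<otimes>\<^bsub>W\<^esub> t) \<noteq> 2}"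

text \<open>The generating sets \<open>J\<close> of the irreducible components \<open>(W_J, J)\<close> of \<open>(W, S)\<close>.\<close>

definition irreducible_components :: "('a, 'b) monoid_scheme \<Rightarrow> 'a set \<Rightarrow> 'a set set" where
  "irreducible_components W S = S // (coxeter_graph W S)\<^sup>*"

text \<open>\<open>(W_J, J)\<close> is of type \<open>A_n\<close>, with Coxeter graph the path \<open>s 1, ..., s n\<close>.\<close>

definition type_A :: "('a, 'b) monoid_scheme \<Rightarrow> 'a set \<Rightarrow> nat \<Rightarrow> bool" where
  "type_A W J n \<longleftrightarrow> (\<exists>s :: nat \<Rightarrow> 'a. bij_betw s {1..n} J \<and>
     (\<forall>i\<in>{1..n}. \<forall>j\<in>{1..n}. i < j \<longrightarrow>
        group.ord W (s i \<otimes>\<^bsub>W\<^esub> s j) = (if j = i + 1 then 3 else 2)))"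

definition product_of_symmetric_groups :: "('a, 'b) monoid_scheme \<Rightarrow> 'a set \<Rightarrow> bool" where
  "product_of_symmetric_groups W S \<longleftrightarrow>
     (\<forall>J \<in> irreducible_components W S. \<exists>n\<ge>1. type_A W J n)"


section \<open>The descent algebra and the Solomon homomorphism\<close>

text \<open>
  Elements of the rational group algebra, and rational functions on \<open>W\<close>, are both represented by
  functions \<open>'a \<Rightarrow> rat\<close> vanishing outside \<open>carrier W\<close>; the element \<open>\<Sum>w. a w * w\<close> of the group
  algebra is the function \<open>a\<close>.
\<close>

definition X_set :: "('a, 'b) monoid_scheme \<Rightarrow> 'a set \<Rightarrow> 'a set \<Rightarrow> 'a set" where
  "X_set W S I =
    {w \<in> carrier W. \<forall>s\<in>I. cox_length W S (w \<otimes>\<^bsub>W\<^esub> s) > cox_length W S w}"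

definition x_elt :: "('a, 'b) monoid_scheme \<Rightarrow> 'a set \<Rightarrow> 'a set \<Rightarrow> 'a \<Rightarrow> rat" where
  "x_elt W S I = indicator (X_set W S I)"

definition x_comb :: "('a, 'b) monoid_scheme \<Rightarrow> 'a set \<Rightarrow> ('a set \<Rightarrow> rat) \<Rightarrow> 'a \<Rightarrow> rat" where
  "x_comb W S c = (\<lambda>w. \<Sum>I\<in>Pow S. c I * x_elt W S I w)"

definition descent_algebra :: "('a, 'b) monoid_scheme \<Rightarrow> 'a set \<Rightarrow> ('a \<Rightarrow> rat) set" where
  "descent_algebra W S = range (x_comb W S)"

definition class_functions :: "('a, 'b) monoid_scheme \<Rightarrow> ('a \<Rightarrow> rat) set" where
  "class_functions W = {f. (\<forall>g. g \<notin> carrier W \<longrightarrow> f g = 0) \<and>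
     (\<forall>g\<in>carrier W. \<forall>h\<in>carrier W. f (h \<otimes>\<^bsub>W\<^esub> g \<otimes>\<^bsub>W\<^esub> inv\<^bsub>W\<^esub> h) = f g)}"

definition induced_char ::
    "('a, 'b) monoid_scheme \<Rightarrow> 'a set \<Rightarrow> ('a \<Rightarrow> rat) \<Rightarrow> 'a \<Rightarrow> rat" where
  "induced_char W H \<chi> g =
    (if g \<in> carrier W then
       (\<Sum>x\<in>carrier W. (if inv\<^bsub>W\<^esub> x \<otimes>\<^bsub>W\<^esub> g \<otimes>\<^bsub>W\<^esub> x \<in> H
          then \<chi> (inv\<^bsub>W\<^esub> x \<otimes>\<^bsub>W\<^esub> g \<otimes>\<^bsub>W\<^esub> x) else 0)) / of_nat (card H)
     else 0)"

text \<open>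
  The linear extension of \<open>x_I \<mapsto> Ind (1_{W_I})\<close>. As the \<open>x_I\<close> are a basis of the descent algebra
  (for \<open>W\<close> finite), the coordinates \<open>c I\<close>, \<open>I \<subseteq> S\<close>, of an element \<open>a\<close> are unique and the choice
  below does not matter.
\<close>

definition solomon_hom ::
    "('a, 'b) monoid_scheme \<Rightarrow> 'a set \<Rightarrow> ('a \<Rightarrow> rat) \<Rightarrow> 'a \<Rightarrow> rat" where
  "solomon_hom W S a =
    (let c = (SOME c. x_comb W S c = a)
     in (\<lambda>g. \<Sum>I\<in>Pow S. c I * induced_char W (generate W I) (\<lambda>_. 1) g))"

end

theory Submission
  imports Defs
begin

text \<open>
  Because the \<open>x_I\<close> are linearly independent (\<open>x_comb_inj\<close>), the image of \<open>\<Phi>\<close> is exactly the span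
  of the permutation characters \<open>Ind 1\<close> of the parabolic subgroups \<open>W_I\<close>
  (\<open>solomon_hom_image\<close>), and the question is whether these characters span all class functions.

  If they do, they separate conjugacy classes. The value of the character of \<open>W_I\<close> at \<open>g\<close> counts the
  \<open>x\<close> with \<open>g\<close> in the conjugate of \<open>W_I\<close> by \<open>x\<close>, and all elements of \<open>W_J\<close> that are elliptic, that is,
  have no eigenvalue \<open>1\<close> on the span of the simple roots in \<open>J\<close>, lie in the same conjugates of parabolic
  subgroups (\<open>elliptic_parabolic\<close>). Hence any two elliptic elements of \<open>W_J\<close> are conjugate in \<open>W\<close>
  and have the same trace (\<open>elliptic_local_trace_eq\<close>). In a dihedral group with \<open>m(s,t) \<ge> 4\<close> the elements
  \<open>s t\<close> and \<open>(s t)\<^sup>2\<close> violate this (\<open>label_le_3\<close>), and in type \<open>D_4\<close> a Coxeter element and its cube \<open>-1\<close>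
  do (\<open>no_branch\<close>). As the graph of a finite Coxeter group has no cycles (\<open>no_cycle\<close>), what remains
  is a disjoint union of paths with all labels \<open>3\<close>. No classification of finite Coxeter
  groups is involved, only the geometric representation and the positivity of roots
  (\<open>act_root_nonneg\<close>).

  Conversely, if all components are of type \<open>A\<close>, list \<open>S\<close> by running through the paths one after
  the other. Adding the generators in this order, each parabolic subgroup \<open>W_{k+1}\<close> is the union of only
  two double cosets of \<open>W_k\<close> (\<open>ordered_double_cosets\<close>), and it follows that every element of \<open>W_I\<close> is
  conjugate to the ordered product \<open>c_K\<close> of the generators in some \<open>K \<subseteq> I\<close>
  (\<open>conj_to_coxeter_elt\<close>). The character of \<open>W_I\<close> is therefore a combination of indicators of the classes of the
  \<open>c_K\<close> with \<open>K \<subseteq> I\<close>, with a nonzero coefficient at \<open>c_I\<close>; induction on \<open>|I|\<close> puts all class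
  indicators into the span (\<open>class_ind_coxeter_elt_in_span\<close>).
\<close>

section \<open>Graphs whose components are paths\<close>

lemma component_subset:
  assumes "E \<subseteq> V \<times> V" "C \<in> V // E\<^sup>*"
  shows "C \<subseteq> V"
proof
  fix x
  assume "x \<in> C"
  then obtain c where c: "c \<in> V" "(c, x) \<in> E\<^sup>*"
    using assms by (auto simp: quotient_def)
  from c(2) c(1) show "x \<in> V"
    using assms(1) by induction auto
qed

text \<open>
  A longest path in the component fills it: a chord would close a cycle, an end with a neighbour
  off the path could be prolonged, and an interior vertex with one would have degree three.
  Acyclicity is stated as: every nonempty set of vertices has a member with at most one neighbour in the set.
\<close>

lemma component_is_path:
  assumes fin: "finite V" and E: "E \<subseteq> V \<times> V" "sym E" "irrefl E"
    and acyc: "\<And>J. J \<subseteq> V \<Longrightarrow> J \<noteq> {} \<Longrightarrow>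
      \<exists>x\<in>J. \<not> (\<exists>y\<in>J. \<exists>z\<in>J. y \<noteq> z \<and> (x, y) \<in> E \<and> (x, z) \<in> E)"
    and deg: "\<And>x y1 y2 y3. (x, y1) \<in> E \<Longrightarrow> (x, y2) \<in> E \<Longrightarrow> (x, y3) \<in> E \<Longrightarrow>
      \<not> distinct [y1, y2, y3]"
    and C: "C \<in> V // E\<^sup>*"
  obtains ps where "distinct ps" "set ps = C"
    "\<And>i j. i < j \<Longrightarrow> j < length ps \<Longrightarrow> (ps ! i, ps ! j) \<in> E \<longleftrightarrow> j = i + 1"
proof -
  obtain c where c: "c \<in> V" "C = E\<^sup>* `` {c}"
    using C by (auto simp: quotient_def)
  have closed: "y \<in> C" if "x \<in> C" "(x, y) \<in> E" for x y
    using that c by (auto intro: rtrancl_into_rtrancl)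
  have CV: "C \<subseteq> V"
    using component_subset[OF E(1) C] .
  have finC: "finite C"
    using CV fin finite_subset by blast
  define path where "path ps \<longleftrightarrow> distinct ps \<and> ps \<noteq> [] \<and> set ps \<subseteq> C \<and> successively (\<lambda>x y. (x, y) \<in> E) ps"
    for ps
  have "path [c]"
    using c by (auto simp: path_def)
  moreover have "length ps \<le> card C" if "path ps" for ps
    using that finC unfolding path_def by (metis card_mono distinct_card)
  ultimately obtain ps where ps: "path ps" and longest: "\<And>qs. path qs \<Longrightarrow> length qs \<le> length ps"
    using ex_has_greatest_nat[of path "[c]" length "Suc (card C)"] by (metis le_imp_less_Suc)
  have dist: "distinct ps" and ne: "ps \<noteq> []" and psC: "set ps \<subseteq> C"
    and succ: "\<And>i. Suc i < length ps \<Longrightarrow> (ps ! i, ps ! Suc i) \<in> E"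
    using ps unfolding path_def by (auto simp: successively_conv_nth)
  have symE: "(y, x) \<in> E" if "(x, y) \<in> E" for x y
    using that E by (auto dest: symD)
  have chord: "j = i + 1" if ij: "i < j" "j < length ps" "(ps ! i, ps ! j) \<in> E" for i j
  proof (rule ccontr)
    assume "j \<noteq> i + 1"
    then have j2: "i + 2 \<le> j"
      using ij by simp
    \<comment> \<open>The chord closes the segment from \<open>i\<close> to \<open>j\<close> to a cycle, with \<open>p\<close> and \<open>n\<close> the cyclic predecessor
      and successor of \<open>k\<close>.\<close>
    let ?J = "(!) ps ` {i..j}"
    have "\<exists>y\<in>?J. \<exists>z\<in>?J. y \<noteq> z \<and> (x, y) \<in> E \<and> (x, z) \<in> E" if "x \<in> ?J" for x
    proof -
      obtain k where k: "x = ps ! k" "i \<le> k" "k \<le> j"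
        using \<open>x \<in> ?J\<close> by auto
      define p where "p = (if k = i then j else k - 1)"
      define n where "n = (if k = j then i else k + 1)"
      have pn: "p \<in> {i..j}" "n \<in> {i..j}" "p \<noteq> n"
        using k j2 unfolding p_def n_def by (auto split: if_splits)
      have "(ps ! k, ps ! p) \<in> E"
      proof (cases "k = i")
        case False
        then have "Suc (k - 1) = k"
          using k by simp
        then show ?thesis
          using succ[of "k - 1"] symE k ij False by (auto simp: p_def)
      qed (use ij in \<open>simp add: p_def\<close>)
      moreover have "(ps ! k, ps ! n) \<in> E"
        using succ[of k] symE k ij by (auto simp: n_def)
      moreover have "ps ! p \<noteq> ps ! n"
        using pn ij dist by (auto simp: nth_eq_iff_index_eq)
      ultimately show ?thesis
        using k pn by blast
    qed
    moreover have "?J \<subseteq> V" "?J \<noteq> {}"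
      using psC CV ij by (auto simp: subset_iff)
    ultimately show False
      using acyc[of ?J] by blast
  qed
  have nbr: "y \<in> set ps" if x: "x \<in> set ps" "(x, y) \<in> E" for x y
  proof (rule ccontr)
    assume y: "y \<notin> set ps"
    have yC: "y \<in> C"
      using closed x psC by blast
    obtain k where k: "x = ps ! k" "k < length ps"
      using x by (auto simp: in_set_conv_nth)
    have "k \<noteq> 0"
    proof
      assume "k = 0"
      then have "path (y # ps)"
        using ps y yC k x symE ne by (auto simp: path_def successively_Cons hd_conv_nth)
      then show False
        using longest by fastforce
    qed
    moreover have "Suc k \<noteq> length ps"
    proof
      assume "Suc k = length ps"
      then have "length ps - 1 = k"
        by simp
      then have "last ps = x"
        using k ne by (simp add: last_conv_nth)
      then have "path (ps @ [y])"
        using ps y yC x by (auto simp: path_def successively_append_iff)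
      then show False
        using longest by fastforce
    qed
    ultimately have k': "Suc (k - 1) = k" "Suc k < length ps"
      using k by auto
    have "(x, ps ! (k - 1)) \<in> E" "(x, ps ! Suc k) \<in> E"
      using succ[of "k - 1"] succ[of k] k k' symE by auto
    moreover have "distinct [ps ! (k - 1), ps ! Suc k, y]"
      using k k' y dist by (auto simp: nth_eq_iff_index_eq)
    ultimately show False
      using deg x by blast
  qed
  have "C \<subseteq> set ps"
  proof
    fix x
    assume "x \<in> C"
    obtain p where p: "p \<in> set ps"
      using ne by (meson list.set_sel(1))
    have "sym (E\<^sup>*)"
      using E sym_rtrancl by blast
    moreover have "(c, x) \<in> E\<^sup>*" "(c, p) \<in> E\<^sup>*"
      using \<open>x \<in> C\<close> p psC c by auto
    ultimately have "(p, x) \<in> E\<^sup>*"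
      by (meson rtrancl_trans symD)
    then show "x \<in> set ps"
      using p by (induction) (auto intro: nbr)
  qed
  then show ?thesis
    using that[of ps] dist psC chord succ by auto
qed

section \<open>Words, parabolic subgroups and length\<close>

locale finite_coxeter_system = coxeter_system +
  assumes finite_carrier: "finite (carrier W)"
begin

abbreviation m :: "'a \<Rightarrow> 'a \<Rightarrow> nat" where
  "m s t \<equiv> ord (s \<otimes> t)"

abbreviation wp :: "'a list \<Rightarrow> 'a" where
  "wp \<equiv> word_prod W"

abbreviation len :: "'a \<Rightarrow> nat" where
  "len \<equiv> cox_length W S"

lemma gen_carrier [simp]: "s \<in> S \<Longrightarrow> s \<in> carrier W"
  using gens_closed by blast

lemma finite_gens [simp]: "finite S"
  using finite_subset[OF gens_closed finite_carrier] .

lemma finite_sub_gens: "J \<subseteq> S \<Longrightarrow> finite J"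
  using finite_subset finite_gens by blast

lemma gen_square [simp]: "s \<in> S \<Longrightarrow> s \<otimes> s = \<one>"
  using pow_ord_eq_1[of s] gens_involutions[of s]
  by (simp add: numeral_2_eq_2)

lemma gen_inv [simp]: "s \<in> S \<Longrightarrow> inv s = s"
  by (rule inv_equality) auto

lemma gen_cancel [simp]: "s \<in> S \<Longrightarrow> w \<in> carrier W \<Longrightarrow> s \<otimes> (s \<otimes> w) = w"
  by (simp flip: m_assoc)

lemma gen_cancel_right [simp]: "s \<in> S \<Longrightarrow> w \<in> carrier W \<Longrightarrow> w \<otimes> s \<otimes> s = w"
  by (simp add: m_assoc)

lemma m_same [simp]: "s \<in> S \<Longrightarrow> m s s = 1"
  by (simp add: ord_eq_1)

lemma m_ge_2:
  assumes "s \<in> S" "t \<in> S" "s \<noteq> t"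
  shows "m s t \<ge> 2"
proof -
  have "m s t \<noteq> 1"
  proof
    assume "m s t = 1"
    then have "s \<otimes> t = \<one>"
      using assms ord_eq_1 by simp
    then have "inv t = s"
      using assms by (intro inv_equality) auto
    then show False
      using assms by simp
  qed
  moreover have "m s t \<ge> 1"
    using finite_carrier assms by (intro ord_ge_1) auto
  ultimately show ?thesis
    by linarith
qed

lemma m_sym:
  assumes "s \<in> S" "t \<in> S"
  shows "m s t = m t s"
proof -
  have "(s \<otimes> t) [^] n = \<one> \<longleftrightarrow> (t \<otimes> s) [^] n = \<one>" for n :: nat
  proof -
    have "t \<otimes> s = inv (s \<otimes> t)"
      using assms by (simp add: inv_mult_group)
    then have "(t \<otimes> s) [^] n = inv ((s \<otimes> t) [^] n)"
      using assms by (simp add: nat_pow_inv)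
    then show ?thesis
      using assms by (simp add: inv_eq_1_iff)
  qed
  then show ?thesis
    unfolding ord_def by simp
qed

lemma commute_if_m_2:
  assumes "s \<in> S" "t \<in> S" "m s t = 2"
  shows "s \<otimes> t = t \<otimes> s"
proof -
  have "(s \<otimes> t) [^] (2::nat) = \<one>"
    using assms pow_ord_eq_1[of "s \<otimes> t"] by simp
  then have "(s \<otimes> t) \<otimes> (s \<otimes> t) = \<one>"
    using assms by (simp add: numeral_2_eq_2)
  then have "inv (s \<otimes> t) = s \<otimes> t"
    using assms by (intro inv_equality) auto
  then show ?thesis
    using assms by (simp add: inv_mult_group)
qed

text \<open>
  The case \<open>m(s,t) = 3\<close> of \<open>braid_relation\<close> below, in multiplied-out form.
\<close>

lemma braid_if_m_3:
  assumes "s \<in> S" "t \<in> S" "m s t = 3"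
  shows "s \<otimes> t \<otimes> s = t \<otimes> s \<otimes> t"
proof -
  have "(s \<otimes> t) [^] (3::nat) = \<one>"
    using assms pow_ord_eq_1[of "s \<otimes> t"] by simp
  then have "(s \<otimes> t \<otimes> s) \<otimes> (t \<otimes> s \<otimes> t) = \<one>"
    using assms by (simp add: numeral_3_eq_3 m_assoc)
  then have "inv (t \<otimes> s \<otimes> t) = s \<otimes> t \<otimes> s"
    using assms by (intro inv_equality) auto
  then show ?thesis
    using assms by (simp add: inv_mult_group m_assoc)
qed

lemma wp_Nil [simp]: "wp [] = \<one>"
  by (simp add: word_prod_def)

lemma wp_Cons [simp]: "wp (s # ws) = s \<otimes> wp ws"
  by (simp add: word_prod_def)

lemma wp_closed [simp]: "set ws \<subseteq> S \<Longrightarrow> wp ws \<in> carrier W"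
  by (induction ws) auto

lemma wp_append [simp]:
  "set us \<subseteq> S \<Longrightarrow> set vs \<subseteq> S \<Longrightarrow> wp (us @ vs) = wp us \<otimes> wp vs"
  by (induction us) (auto simp: m_assoc)

lemma wp_in_generate:
  assumes "J \<subseteq> S" "set ws \<subseteq> J"
  shows "wp ws \<in> generate W J"
  using assms(2) by (induction ws) (auto intro: generate.intros)

lemma generate_eq_words:
  assumes "J \<subseteq> S"
  shows "generate W J = wp ` {ws. set ws \<subseteq> J}"
proof
  show "wp ` {ws. set ws \<subseteq> J} \<subseteq> generate W J"
    using wp_in_generate[OF assms] by blast
  show "generate W J \<subseteq> wp ` {ws. set ws \<subseteq> J}"
  proof
    fix x
    assume "x \<in> generate W J"
    then show "x \<in> wp ` {ws. set ws \<subseteq> J}"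
    proof induction
      case one
      show ?case
        by (intro image_eqI[of _ _ "[]"]) auto
    next
      case (incl h)
      then show ?case
        using assms by (intro image_eqI[of _ _ "[h]"]) auto
    next
      case (inv h)
      then show ?case
        using assms by (intro image_eqI[of _ _ "[h]"]) auto
    next
      case (eng h1 h2)
      then obtain u v where "set u \<subseteq> J" "set v \<subseteq> J" "h1 = wp u" "h2 = wp v"
        by blast
      then show ?case
        using assms by (intro image_eqI[of _ _ "u @ v"]) auto
    qed
  qed
qed

lemma carrier_word:
  assumes "w \<in> carrier W"
  obtains ws where "set ws \<subseteq> S" "w = wp ws"
  using assms generate_eq_words[of S] gens_generate by auto

lemma subgroup_generate: "J \<subseteq> S \<Longrightarrow> subgroup (generate W J) W"
  using gens_closed by (intro generate_is_subgroup) auto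

lemma generate_carrier: "J \<subseteq> S \<Longrightarrow> w \<in> generate W J \<Longrightarrow> w \<in> carrier W"
  using generate_in_carrier[of J w] gens_closed by auto

lemma finite_generate: "J \<subseteq> S \<Longrightarrow> finite (generate W J)"
  using finite_subset[OF _ finite_carrier] generate_carrier by blast

lemma reduced_word:
  assumes "w \<in> carrier W"
  obtains ws where "set ws \<subseteq> S" "w = wp ws" "length ws = len w"
proof -
  have "\<exists>n. \<exists>ws\<in>lists S. length ws = n \<and> wp ws = w"
    using carrier_word[OF assms] by (metis in_lists_conv_set subsetD)
  from LeastI_ex[OF this] show ?thesis
    using that unfolding cox_length_def by (auto simp: in_lists_conv_set subset_iff)
qed

lemma len_wp_le: "set ws \<subseteq> S \<Longrightarrow> len (wp ws) \<le> length ws"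
  unfolding cox_length_def by (intro Least_le) auto

lemma coxeter_cong_words:
  assumes "coxeter_cong W S u v"
  shows "set u \<subseteq> S \<and> set v \<subseteq> S \<and> even (length u + length v)"
  using assms
proof induction
  case (rel s t u v)
  have "length (concat (replicate n [s, t])) = 2 * n" for n
    by (induction n) auto
  moreover have "set (concat (replicate n [s, t])) \<subseteq> S" for n
    using rel by (induction n) auto
  ultimately show ?case
    using rel by auto
qed auto

text \<open>
  The Coxeter relations have even length, so the sign of a word depends only on its product.
  This is what excludes \<open>len (w \<otimes> s) = len w\<close> below.
\<close>

lemma parity_len:
  assumes "set ws \<subseteq> S"
  shows "even (len (wp ws) + length ws)"
proof -
  obtain us where us: "set us \<subseteq> S" "wp ws = wp us" "length us = len (wp ws)"
    using reduced_word[of "wp ws"] assms by auto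
  then have "coxeter_cong W S us ws"
    using presentation[of us ws] assms by (simp add: in_lists_conv_set subset_iff)
  then show ?thesis
    using coxeter_cong_words us by metis
qed

lemma len_one [simp]: "len \<one> = 0"
  using len_wp_le[of "[]"] by simp

lemma len_mult_wp:
  assumes "w \<in> carrier W" "set us \<subseteq> S"
  shows "len (w \<otimes> wp us) \<le> len w + length us"
proof -
  obtain ws where ws: "set ws \<subseteq> S" "w = wp ws" "length ws = len w"
    using reduced_word[OF assms(1)] .
  have "len (wp (ws @ us)) \<le> length (ws @ us)"
    using ws assms by (intro len_wp_le) auto
  then show ?thesis
    using ws assms by simp
qed

lemma len_mult_gen:
  assumes "w \<in> carrier W" "s \<in> S"
  shows "len (w \<otimes> s) = len w + 1 \<or> len w = len (w \<otimes> s) + 1"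
proof -
  have 1: "len (w \<otimes> s) \<le> len w + 1"
    using len_mult_wp[of w "[s]"] assms by simp
  have 2: "len w \<le> len (w \<otimes> s) + 1"
    using len_mult_wp[of "w \<otimes> s" "[s]"] assms by simp
  obtain ws where ws: "set ws \<subseteq> S" "w = wp ws" "length ws = len w"
    using reduced_word[OF assms(1)] .
  have "even (len (wp (ws @ [s])) + length (ws @ [s]))"
    using ws assms by (intro parity_len) auto
  then have "even (len (w \<otimes> s) + len w + 1)"
    using ws assms by simp
  then have "len (w \<otimes> s) \<noteq> len w"
    by auto
  then show ?thesis
    using 1 2 by linarith
qed

lemma ex_right_descent:
  assumes "w \<in> carrier W" "w \<noteq> \<one>"
  obtains s where "s \<in> S" "len w = len (w \<otimes> s) + 1"
proof -
  obtain ws where ws: "set ws \<subseteq> S" "w = wp ws" "length ws = len w"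
    using reduced_word[OF assms(1)] .
  then have "ws \<noteq> []"
    using assms by auto
  then obtain us s where us: "ws = us @ [s]"
    using rev_exhaust by blast
  have "w \<otimes> s = wp us"
    using ws us by simp
  then have "len (w \<otimes> s) < len w"
    using len_wp_le[of us] ws us by auto
  then show ?thesis
    using len_mult_gen[of w s] that[of s] ws us assms by auto
qed

section \<open>The geometric representation\<close>

text \<open>
  The inner product of \<open>v\<close> with the simple root of \<open>s\<close>. A vector is a function of which only the
  coordinates in \<open>S\<close> matter, the coefficients on the simple roots. The diagonal value
  \<open>- cos (pi / m s s) = - cos pi = 1\<close> is correct because \<open>m s s = 1\<close>.
\<close>

definition bform :: "'a \<Rightarrow> ('a \<Rightarrow> real) \<Rightarrow> real" where
  "bform s v = (\<Sum>r\<in>S. - cos (pi / real (m s r)) * v r)"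

definition reflect :: "'a \<Rightarrow> ('a \<Rightarrow> real) \<Rightarrow> 'a \<Rightarrow> real" where
  "reflect s v = v(s := v s - 2 * bform s v)"

abbreviation word_act :: "'a list \<Rightarrow> ('a \<Rightarrow> real) \<Rightarrow> 'a \<Rightarrow> real" where
  "word_act ws \<equiv> foldr reflect ws"

definition simple_root :: "'a \<Rightarrow> 'a \<Rightarrow> real" where
  "simple_root s = (\<lambda>r. if r = s then 1 else 0)"

lemma bform_comb:
  "bform s (\<lambda>r. a * u r + b * v r) = a * bform s u + b * bform s v"
  unfolding bform_def by (simp add: sum_distrib_left flip: sum.distrib)
    (intro sum.cong HOL.refl, simp only: distrib_left mult.left_commute)

lemma reflect_comb:
  "reflect s (\<lambda>r. a * u r + b * v r) = (\<lambda>r. a * reflect s u r + b * reflect s v r)"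
  by (auto simp: reflect_def bform_comb fun_eq_iff algebra_simps)

lemma word_act_comb:
  "word_act ws (\<lambda>r. a * u r + b * v r) = (\<lambda>r. a * word_act ws u r + b * word_act ws v r)"
  by (induction ws) (simp_all add: reflect_comb)

lemma bform_root:
  assumes "t \<in> S"
  shows "bform s (simple_root t) = - cos (pi / real (m s t))"
proof -
  have "bform s (simple_root t) = (\<Sum>r\<in>S. if r = t then - cos (pi / real (m s t)) else 0)"
    unfolding bform_def simple_root_def by (intro sum.cong) auto
  then show ?thesis
    using assms by simp
qed

lemma reflect_eq: "reflect s v = (\<lambda>r. 1 * v r + (- 2 * bform s v) * simple_root s r)"
  by (auto simp: reflect_def simple_root_def)

lemma bform_reflect: "s \<in> S \<Longrightarrow> bform s (reflect s v) = - bform s v"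
  unfolding reflect_eq bform_comb by (simp add: bform_root)

lemma reflect_reflect: "s \<in> S \<Longrightarrow> reflect s (reflect s v) = v"
  using bform_reflect[of s v] by (auto simp: reflect_def fun_eq_iff)

lemma reflect_fixes: "bform s v = 0 \<Longrightarrow> reflect s v = v"
  by (simp add: reflect_def)

lemma word_act_fixes:
  "(\<And>s. s \<in> set ws \<Longrightarrow> bform s v = 0) \<Longrightarrow> word_act ws v = v"
  by (induction ws) (auto simp: reflect_fixes)

lemma word_act_outside: "r \<notin> set ws \<Longrightarrow> word_act ws v r = v r"
  by (induction ws) (auto simp: reflect_def)

primrec alternating :: "'a \<Rightarrow> 'a \<Rightarrow> nat \<Rightarrow> 'a list" where
  "alternating s t 0 = []"
| "alternating s t (Suc k) = alternating t s k @ [t]"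

definition plane :: "'a \<Rightarrow> 'a \<Rightarrow> real \<Rightarrow> real \<Rightarrow> 'a \<Rightarrow> real" where
  "plane s t a b = (\<lambda>r. a * simple_root s r + b * simple_root t r)"

lemma plane_swap: "plane s t a b = plane t s b a"
  by (auto simp: plane_def)

lemma bform_plane:
  assumes "s \<in> S" "t \<in> S"
  shows "bform t (plane s t a b) = b - a * cos (pi / real (m s t))"
  unfolding plane_def bform_comb using assms m_sym[of s t] by (simp add: bform_root)

lemma reflect_plane:
  assumes "s \<in> S" "t \<in> S" "s \<noteq> t"
  shows "reflect t (plane s t a b) = plane s t a (2 * cos (pi / real (m s t)) * a - b)"
  using assms by (auto simp: reflect_def bform_plane fun_eq_iff)
    (auto simp: plane_def simple_root_def algebra_simps)

lemma alternating_set: "set (alternating s t k) \<subseteq> {s, t}"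
  by (induction k arbitrary: s t) auto

lemma alternating_subset: "s \<in> S \<Longrightarrow> t \<in> S \<Longrightarrow> set (alternating s t k) \<subseteq> S"
  using alternating_set[of s t k] by auto

lemma length_alternating [simp]: "length (alternating s t k) = k"
  by (induction k arbitrary: s t) auto

lemma alternating_double: "alternating s t (2 * k) = concat (replicate k [s, t])"
proof (induction k)
  case (Suc k)
  have "concat (replicate k [s, t]) @ [s, t] = [s, t] @ concat (replicate k [s, t])" for k
    by (induction k) auto
  then show ?case
    using Suc by simp
qed auto

text \<open>
  In the dihedral plane, alternating reflections shift the index \<open>j\<close> of the coefficient pair
  \<open>sin ((j+1) \<theta>)\<close>, \<open>sin (j \<theta>)\<close>, because \<open>sin ((j+2) \<theta>) = 2 cos \<theta> sin ((j+1) \<theta>) - sin (j \<theta>)\<close>. Periodicity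
  of the sine gives the Coxeter relation, and its positivity on \<open>[0, pi]\<close> gives positive roots.
\<close>

lemma word_act_alternating_plane:
  assumes "s \<in> S" "t \<in> S" "s \<noteq> t" and \<theta>: "\<theta> = pi / real (m s t)"
  shows "word_act (alternating s t k) (plane s t (sin (real (j + 1) * \<theta>)) (sin (real j * \<theta>))) =
    (if even k then plane s t (sin (real (j + k + 1) * \<theta>)) (sin (real (j + k) * \<theta>))
     else plane s t (sin (real (j + k) * \<theta>)) (sin (real (j + k + 1) * \<theta>)))"
  using assms
proof (induction k arbitrary: s t j)
  case (Suc k)
  have trig: "2 * cos \<theta> * sin (real (j + 1) * \<theta>) - sin (real j * \<theta>) = sin (real (j + 2) * \<theta>)"
  proof -
    have 1: "real (j + 2) * \<theta> = real (j + 1) * \<theta> + \<theta>" "real j * \<theta> = real (j + 1) * \<theta> - \<theta>"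
      by (simp_all add: algebra_simps)
    show ?thesis
      unfolding 1 sin_add sin_diff by simp
  qed
  have "word_act (alternating s t (Suc k)) (plane s t (sin (real (j + 1) * \<theta>)) (sin (real j * \<theta>))) =
     word_act (alternating t s k) (plane s t (sin (real (j + 1) * \<theta>)) (sin (real (j + 2) * \<theta>)))"
    using Suc.prems reflect_plane[of s t] trig by simp
  also have "\<dots> = word_act (alternating t s k)
      (plane t s (sin (real (Suc j + 1) * \<theta>)) (sin (real (Suc j) * \<theta>)))"
    by (subst plane_swap) simp
  also have "\<dots> = (if even k then plane t s (sin (real (Suc j + k + 1) * \<theta>)) (sin (real (Suc j + k) * \<theta>))
     else plane t s (sin (real (Suc j + k) * \<theta>)) (sin (real (Suc j + k + 1) * \<theta>)))"
    using Suc.prems m_sym[of s t] by (intro Suc.IH) auto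
  finally show ?case
    by (simp add: plane_swap[of t s])
qed auto

lemma sin_pi_div_pos: "n \<ge> 2 \<Longrightarrow> sin (pi / real n) > 0"
  by (intro sin_gt_zero) (auto simp: field_simps)

lemma word_act_plane_scale:
  "word_act ws (plane s t (x * a) (x * b)) = (\<lambda>r. x * word_act ws (plane s t a b) r)"
proof -
  have "plane s t (x * a) (x * b) = (\<lambda>r. x * plane s t a b r + 0 * plane s t a b r)"
    by (auto simp: plane_def algebra_simps)
  then show ?thesis
    by (simp only: word_act_comb) simp
qed

lemma word_act_plane:
  "word_act ws (plane s t a b) = (\<lambda>r. a * word_act ws (simple_root s) r + b * word_act ws (simple_root t) r)"
  unfolding plane_def by (rule word_act_comb)

lemma relation_acts_trivially_on_plane:
  assumes st: "s \<in> S" "t \<in> S" "s \<noteq> t"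
  shows "word_act (alternating s t (2 * m s t)) (plane s t a b) = plane s t a b"
proof -
  let ?n = "m s t" and ?w = "word_act (alternating s t (2 * m s t))"
  define \<theta> where "\<theta> = pi / real ?n"
  have n: "?n \<ge> 2"
    using m_ge_2[OF st] .
  have pos: "sin \<theta> > 0"
    unfolding \<theta>_def using sin_pi_div_pos[OF n] .
  have per: "sin (real (j + 2 * ?n) * \<theta>) = sin (real j * \<theta>)" for j
  proof -
    have "real (j + 2 * ?n) * \<theta> = real j * \<theta> + 2 * pi"
      using n by (simp add: \<theta>_def field_simps)
    then show ?thesis
      by simp
  qed
  have fix_j: "?w (plane s t (sin (real (j + 1) * \<theta>)) (sin (real j * \<theta>))) =
      plane s t (sin (real (j + 1) * \<theta>)) (sin (real j * \<theta>))" for j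
    using word_act_alternating_plane[OF st \<theta>_def, of "2 * ?n" j] per[of j] per[of "j + 1"]
    by (simp add: algebra_simps)
  \<comment> \<open>The index \<open>j = 0\<close> gives a multiple of the root of \<open>s\<close>, the index \<open>j = m - 1\<close> one of the root of \<open>t\<close>.\<close>
  have "?w (plane s t (sin \<theta> * 1) (sin \<theta> * 0)) = plane s t (sin \<theta> * 1) (sin \<theta> * 0)"
    using fix_j[of 0] by simp
  then have 1: "?w (simple_root s) = simple_root s"
    unfolding word_act_plane_scale using pos by (auto simp: plane_def fun_eq_iff word_act_comb[where b = 0, simplified])
  have "real (?n - 1 + 1) * \<theta> = pi"
    using n by (simp add: \<theta>_def)
  moreover have "real (?n - 1) * \<theta> = pi - \<theta>"
    using n by (simp add: \<theta>_def field_simps of_nat_diff)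
  ultimately have "?w (plane s t (sin \<theta> * 0) (sin \<theta> * 1)) = plane s t (sin \<theta> * 0) (sin \<theta> * 1)"
    using fix_j[of "?n - 1"] by (simp only: sin_pi_minus sin_pi mult_zero_right mult_1_right)
  then have 2: "?w (simple_root t) = simple_root t"
    unfolding word_act_plane_scale using pos by (auto simp: plane_def fun_eq_iff word_act_comb[where a = 0, simplified])
  show ?thesis
    unfolding word_act_plane 1 2 by (simp add: plane_def)
qed

text \<open>
  For \<open>s \<noteq> t\<close>, the form is nondegenerate on the plane of the two roots, so every vector is the sum of
  one in the plane and one orthogonal to it; both are fixed.
\<close>

lemma relation_acts_trivially:
  assumes "s \<in> S" "t \<in> S"
  shows "word_act (concat (replicate (m s t) [s, t])) v = v"
proof (cases "s = t")
  case True
  then show ?thesis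
    using assms by (simp add: reflect_reflect)
next
  case False
  let ?n = "m s t" and ?w = "word_act (alternating s t (2 * m s t))"
  define c where "c = cos (pi / real ?n)"
  have n: "?n \<ge> 2"
    using m_ge_2[OF assms False] .
  have "(sin (pi / real ?n))\<^sup>2 > 0"
    using sin_pi_div_pos[OF n] by simp
  then have c: "1 - c * c \<noteq> 0"
    using sin_cos_squared_add[of "pi / real ?n"] unfolding c_def by (simp add: power2_eq_square)
  \<comment> \<open>The coordinates of the orthogonal projection of \<open>v\<close> to the plane.\<close>
  define a where "a = (bform s v + c * bform t v) / (1 - c * c)"
  define b where "b = (bform t v + c * bform s v) / (1 - c * c)"
  have ab: "a - b * c = bform s v" "b - a * c = bform t v"
  proof -
    have 1: "a * (1 - c * c) = bform s v + c * bform t v"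
      and 2: "b * (1 - c * c) = bform t v + c * bform s v"
      using c by (simp_all add: a_def b_def)
    have "(a - b * c) * (1 - c * c) = a * (1 - c * c) - c * (b * (1 - c * c))"
      "(b - a * c) * (1 - c * c) = b * (1 - c * c) - c * (a * (1 - c * c))"
      by (simp_all add: algebra_simps)
    then have "(a - b * c) * (1 - c * c) = bform s v * (1 - c * c)"
      "(b - a * c) * (1 - c * c) = bform t v * (1 - c * c)"
      unfolding 1 2 by (simp_all add: algebra_simps)
    then show "a - b * c = bform s v" "b - a * c = bform t v"
      using c by simp_all
  qed
  let ?u = "\<lambda>r. 1 * v r + (-1) * plane s t a b r"
  have "bform s ?u = 0" "bform t ?u = 0"
    unfolding bform_comb
    using assms bform_plane[of s t a b] bform_plane[of t s b a] ab m_sym[of t s]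
    by (simp_all add: plane_swap[of t s] c_def)
  then have "?w ?u = ?u"
    using alternating_set[of s t "2 * ?n"] by (intro word_act_fixes) blast
  then have "?w v = v"
    unfolding word_act_comb relation_acts_trivially_on_plane[OF assms False]
    by (auto simp: fun_eq_iff)
  then show ?thesis
    by (simp add: alternating_double)
qed

lemma coxeter_cong_act:
  assumes "coxeter_cong W S u v"
  shows "word_act u x = word_act v x"
  using assms
proof (induction arbitrary: x)
  case (rel s t u v)
  then show ?case
    by (simp add: relation_acts_trivially)
next
  case (trans u v w)
  show ?case
    using trans.IH by (rule HOL.trans)
next
  case (sym u v)
  show ?case
    by (rule sym.IH[symmetric])
qed simp

text \<open>
  By \<open>act_wp\<close>, which rests on the presentation of \<open>W\<close>, any word for \<open>w\<close> gives the same operator.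
\<close>

definition act :: "'a \<Rightarrow> ('a \<Rightarrow> real) \<Rightarrow> 'a \<Rightarrow> real" where
  "act w = word_act (SOME ws. set ws \<subseteq> S \<and> wp ws = w)"

lemma act_wp:
  assumes "set ws \<subseteq> S"
  shows "act (wp ws) = word_act ws"
proof -
  let ?us = "SOME us. set us \<subseteq> S \<and> wp us = wp ws"
  have "set ?us \<subseteq> S \<and> wp ?us = wp ws"
    using assms by (rule_tac someI[where P = "\<lambda>us. set us \<subseteq> S \<and> wp us = wp ws"]) simp
  then have "coxeter_cong W S ?us ws"
    using presentation[of ?us ws] assms by (simp add: in_lists_conv_set subset_iff)
  then show ?thesis
    unfolding act_def using coxeter_cong_act by blast
qed

lemma act_mult:
  assumes "x \<in> carrier W" "y \<in> carrier W"
  shows "act (x \<otimes> y) v = act x (act y v)"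
proof -
  obtain u where u: "set u \<subseteq> S" "x = wp u"
    using carrier_word assms by blast
  obtain u' where u': "set u' \<subseteq> S" "y = wp u'"
    using carrier_word assms by blast
  show ?thesis
    using act_wp[of "u @ u'"] u u' by (simp add: act_wp)
qed

lemma act_gen: "s \<in> S \<Longrightarrow> act s = reflect s"
  using act_wp[of "[s]"] by (auto simp: fun_eq_iff)

lemma act_one [simp]: "act \<one> v = v"
  using act_wp[of "[]"] by simp

lemma act_comb:
  "act w (\<lambda>r. a * u r + b * v r) = (\<lambda>r. a * act w u r + b * act w v r)"
  unfolding act_def by (rule word_act_comb)

lemma act_scale: "act w (\<lambda>r. a * v r) = (\<lambda>r. a * act w v r)"
  using act_comb[of w a v 0 v] by simp

lemma act_minus: "act w (\<lambda>r. - v r) = (\<lambda>r. - act w v r)"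
  using act_scale[of w "-1" v] by simp

lemma act_sum:
  assumes "finite A"
  shows "act w (\<lambda>r. \<Sum>i\<in>A. c i * v i r) = (\<lambda>r. \<Sum>i\<in>A. c i * act w (v i) r)"
  using assms
proof (induction A)
  case empty
  show ?case
    using act_scale[of w 0 undefined] by simp
next
  case (insert x F)
  then show ?case
    using act_comb[of w "c x" "v x" 1 "\<lambda>r. \<Sum>i\<in>F. c i * v i r"] by simp
qed

lemma act_outside:
  assumes "J \<subseteq> S" "w \<in> generate W J" "r \<notin> J"
  shows "act w v r = v r"
proof -
  obtain ws where ws: "set ws \<subseteq> J" "w = wp ws"
    using assms generate_eq_words by auto
  then have "set ws \<subseteq> S" "r \<notin> set ws"
    using assms by auto
  then show ?thesis
    using ws act_wp[of ws] word_act_outside[of r ws] by simp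
qed

lemma act_gen_root: "s \<in> S \<Longrightarrow> act s (simple_root s) = (\<lambda>r. - simple_root s r)"
  by (auto simp: act_gen reflect_eq bform_root)

section \<open>Positivity of roots\<close>

text \<open>
  Alternating words concatenate; the two alternatives arise because the first letter of
  the result depends on parity. With \<open>j = k = m(s,t)\<close> this turns \<open>(s t)^m = 1\<close> into the braid relation.
\<close>

lemma alternating_wp_quotient:
  assumes "s \<in> S" "t \<in> S"
  shows "wp (alternating t s j) \<otimes> inv (wp (alternating s t k)) \<in> {wp (alternating s t (j + k)), wp (alternating t s (j + k))}"
  using assms
proof (induction k arbitrary: s t j)
  case 0
  then show ?case
    using alternating_subset[of t s j] by simp
next
  case (Suc k)
  have "wp (alternating t s j) \<otimes> inv (wp (alternating s t (Suc k))) = wp (alternating s t (Suc j)) \<otimes> inv (wp (alternating t s k))"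
    using Suc.prems alternating_subset[of t s j] alternating_subset[of t s k] alternating_subset[of s t k]
    by (simp add: inv_mult_group m_assoc)
  then show ?case
    using Suc.IH[of t s "Suc j"] Suc.prems by auto
qed

lemma wp_relation:
  assumes "s \<in> S" "t \<in> S"
  shows "wp (alternating s t (2 * m s t)) = \<one>"
proof -
  have "wp (concat (replicate n [s, t])) = (s \<otimes> t) [^] n" for n
  proof (induction n)
    case (Suc n)
    then have "wp (concat (replicate (Suc n) [s, t])) = (s \<otimes> t) \<otimes> (s \<otimes> t) [^] n"
      using assms by (simp add: m_assoc)
    then show ?case
      using assms nat_pow_Suc2[of "s \<otimes> t" n] by simp
  qed auto
  then show ?thesis
    using assms by (simp add: alternating_double)
qed

lemma braid_relation:
  assumes "s \<in> S" "t \<in> S"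
  shows "wp (alternating s t (m s t)) = wp (alternating t s (m s t))"
proof -
  have "wp (alternating t s (m s t)) \<otimes> inv (wp (alternating s t (m s t))) = \<one>"
    using alternating_wp_quotient[OF assms, of "m s t" "m s t"]
      wp_relation[OF assms] wp_relation[of t s] m_sym[OF assms] assms
    by (auto simp flip: mult_2)
  then show ?thesis
    using assms alternating_subset[of s t "m s t"] alternating_subset[of t s "m s t"]
    by (metis inv_closed inv_equality inv_inv wp_closed)
qed

lemma alternating_split:
  assumes "s \<in> S" "t \<in> S"
  shows "\<exists>us. set us \<subseteq> S \<and> length us = i \<and> alternating s t (i + j) = us @ alternating s t j"
  using assms
proof (induction j arbitrary: s t)
  case 0
  then show ?case
    using alternating_subset[of s t i] by simp
next
  case (Suc j)
  then show ?case
    by (metis add_Suc_right alternating.simps(2) append.assoc)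
qed

text \<open>
  The factor \<open>v\<close> is the element of minimal length in the coset \<open>w W_{s,t}\<close>. It is reached by splitting off
  from a reduced word of \<open>w\<close> an alternating suffix that is as long as possible.
\<close>

lemma dihedral_factorization:
  assumes "w \<in> carrier W" "s \<in> S" "t \<in> S" and desc: "len w = len (w \<otimes> t) + 1"
  obtains v k where "v \<in> carrier W" "k \<ge> 1" "w = v \<otimes> wp (alternating s t k)" "len w = len v + k"
    "len (v \<otimes> s) = len v + 1" "len (v \<otimes> t) = len v + 1"
proof -
  define P where "P k \<longleftrightarrow> (\<exists>v\<in>carrier W. w = v \<otimes> wp (alternating s t k) \<and> len w = len v + k)" for k
  have P1: "P 1"
    unfolding P_def using assms by (intro bexI[of _ "w \<otimes> t"]) auto
  have bound: "P k \<Longrightarrow> k \<le> len w" for k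
    unfolding P_def by auto
  define k where "k = (GREATEST k. P k)"
  have "P k"
    unfolding k_def using P1 bound by (rule GreatestI_nat)
  then obtain v where v: "v \<in> carrier W" "w = v \<otimes> wp (alternating s t k)" "len w = len v + k"
    unfolding P_def by auto
  have k1: "k \<ge> 1"
    unfolding k_def using P1 bound by (rule Greatest_le_nat)
  have "\<not> P (Suc k)"
    unfolding k_def using bound Greatest_le_nat[of P "Suc (GREATEST k. P k)" "len w"] by auto
  obtain x where x: "set x \<subseteq> S" "length x = 1" "alternating s t (1 + k) = x @ alternating s t k"
    using alternating_split[OF assms(2,3), of 1 k] by auto
  obtain y where y: "set y \<subseteq> S" "length y = 1" "alternating s t (1 + (k - 1)) = y @ alternating s t (k - 1)"
    using alternating_split[OF assms(2,3), of 1 "k - 1"] by auto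
  obtain p where p: "x = [p]" using x by (cases x) auto
  obtain q where q: "y = [q]" using y by (cases y) auto
  note alt = alternating_subset[OF assms(2,3)]
  have S: "p \<in> S" "q \<in> S"
    using x y p q by auto
  have pq: "{p, q} = {s, t}"
  proof -
    have "\<exists>p q. {p, q} = {s, t} \<and> alternating s t (Suc (Suc j)) = p # q # alternating s t j" for j
    proof (induction j arbitrary: s t)
      case 0
      show ?case by auto
    next
      case (Suc j)
      then show ?case
        by (metis alternating.simps(2) append_Cons insert_commute)
    qed
    from this[of "k - 1"] show ?thesis
      using x y p q k1 by auto
  qed
  have kq: "alternating s t k = q # alternating s t (k - 1)"
    using y q k1 by simp
  \<comment> \<open>The letter \<open>p\<close> would prolong the alternating suffix, against its maximality.\<close>
  have "len (v \<otimes> p) = len v + 1"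
  proof (rule ccontr)
    assume "len (v \<otimes> p) \<noteq> len v + 1"
    then have "len v = len (v \<otimes> p) + 1"
      using len_mult_gen[of v p] v S by auto
    then have "P (Suc k)"
      unfolding P_def using x p v S alt
      by (intro bexI[of _ "v \<otimes> p"]) (auto simp: m_assoc)
    then show False
      using \<open>\<not> P (Suc k)\<close> by simp
  qed
  \<comment> \<open>The letter \<open>q\<close> is the first one of the suffix; it would cancel, against \<open>len w = len v + k\<close>.\<close>
  moreover have "len (v \<otimes> q) = len v + 1"
  proof (rule ccontr)
    assume "len (v \<otimes> q) \<noteq> len v + 1"
    then have *: "len v = len (v \<otimes> q) + 1"
      using len_mult_gen[of v q] v S by auto
    have "w = (v \<otimes> q) \<otimes> wp (alternating s t (k - 1))"
      using v kq S alt by (simp add: m_assoc)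
    then have "len w \<le> len (v \<otimes> q) + (k - 1)"
      using len_mult_wp[of "v \<otimes> q" "alternating s t (k - 1)"] v S alt by simp
    then show False
      using * v k1 by simp
  qed
  ultimately have "len (v \<otimes> s) = len v + 1" "len (v \<otimes> t) = len v + 1"
    using pq by (auto simp: doubleton_eq_iff)
  then show ?thesis
    using that v k1 by blast
qed

text \<open>
  The fundamental fact about root systems: \<open>w\<close> makes a simple root positive if multiplication by its
  reflection lengthens \<open>w\<close>. Writing \<open>w = v u\<close> with \<open>u\<close> in a dihedral parabolic subgroup, the trigonometric formula
  makes \<open>u\<close> send the root of \<open>s\<close> to a nonnegative combination of two simple roots, and by induction the shorter \<open>v\<close> keeps
  both positive.
\<close>

theorem act_root_nonneg:
  assumes "w \<in> carrier W" "s \<in> S" "len (w \<otimes> s) > len w"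
  shows "act w (simple_root s) r \<ge> 0"
  using assms
proof (induction "len w" arbitrary: w s r rule: less_induct)
  case less
  show ?case
  proof (cases "w = \<one>")
    case True
    then show ?thesis
      by (simp add: simple_root_def)
  next
    case False
    then obtain t where t: "t \<in> S" "len w = len (w \<otimes> t) + 1"
      using ex_right_descent less.prems(1) by blast
    then have st: "s \<noteq> t"
      using less.prems by auto
    obtain v k where v: "v \<in> carrier W" "k \<ge> 1" "w = v \<otimes> wp (alternating s t k)" "len w = len v + k"
      "len (v \<otimes> s) = len v + 1" "len (v \<otimes> t) = len v + 1"
      using dihedral_factorization[of w s t] less.prems t by blast
    note alt = alternating_subset[OF less.prems(2) t(1)] alternating_subset[OF t(1) less.prems(2)]
    let ?n = "m s t"
    have n: "?n \<ge> 2"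
      using m_ge_2 less.prems t st by blast
    \<comment> \<open>A suffix of length at least \<open>m(s,t)\<close> could be rewritten by the braid relation to end in \<open>s\<close>,
      and then \<open>w \<otimes> s\<close> would be shorter than \<open>w\<close>.\<close>
    have kn: "k < ?n"
    proof (rule ccontr)
      assume "\<not> k < ?n"
      then obtain i where i: "k = i + ?n"
        by (metis add.commute le_Suc_ex not_less)
      obtain us where us: "set us \<subseteq> S" "length us = i" "alternating s t (i + ?n) = us @ alternating s t ?n"
        using alternating_split less.prems t by blast
      have "wp (alternating t s ?n) \<otimes> s = wp (alternating s t (?n - 1))"
        using n alt less.prems by (cases ?n) auto
      then have "w \<otimes> s = v \<otimes> wp (us @ alternating s t (?n - 1))"
        using v i us alt braid_relation[OF less.prems(2) t(1)] less.prems
        by (simp add: m_assoc)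
      then have "len (w \<otimes> s) \<le> len v + (i + (?n - 1))"
        using len_mult_wp[of v "us @ alternating s t (?n - 1)"] v us alt by simp
      then show False
        using less.prems v i n by simp
    qed
    define \<theta> where "\<theta> = pi / real ?n"
    have pos: "sin (real j * \<theta>) \<ge> 0" if "j \<le> ?n" for j
    proof (rule sin_ge_zero)
      have "real j * \<theta> \<le> real ?n * \<theta>"
        using that by (intro mult_right_mono) (auto simp: \<theta>_def)
      also have "\<dots> = pi"
        using n by (simp add: \<theta>_def)
      finally show "real j * \<theta> \<le> pi" .
    qed (simp add: \<theta>_def)
    obtain a b where ab: "a \<ge> 0" "b \<ge> 0" "word_act (alternating s t k) (plane s t (sin \<theta>) 0) = plane s t a b"
      using word_act_alternating_plane[OF less.prems(2) t(1) st \<theta>_def, of k 0] pos[of k] pos[of "k + 1"] kn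
      by (cases "even k") auto
    have "act v (word_act (alternating s t k) (plane s t (sin \<theta>) 0)) r \<ge> 0"
      unfolding ab(3) unfolding plane_def act_comb
      using less.hyps[of v s] less.hyps[of v t] v ab less.prems t by simp
    moreover have "act v (word_act (alternating s t k) (plane s t (sin \<theta>) 0)) r = sin \<theta> * act w (simple_root s) r"
    proof -
      have "act w (plane s t (sin \<theta>) 0) = act v (word_act (alternating s t k) (plane s t (sin \<theta>) 0))"
        using v alt by (simp add: act_mult act_wp)
      moreover have "plane s t (sin \<theta>) 0 = (\<lambda>r. sin \<theta> * simple_root s r)"
        by (simp add: plane_def)
      ultimately show ?thesis
        by (metis act_scale)
    qed
    ultimately show ?thesis
      using sin_pi_div_pos[OF n] by (simp add: \<theta>_def zero_le_mult_iff)
  qed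
qed

lemma act_root_nonpos:
  assumes "w \<in> carrier W" "s \<in> S" "len (w \<otimes> s) < len w"
  shows "act w (simple_root s) r \<le> 0"
proof -
  have "act (w \<otimes> s) (simple_root s) r = - act w (simple_root s) r"
    using assms by (simp add: act_mult act_gen_root act_minus)
  moreover have "act (w \<otimes> s) (simple_root s) r \<ge> 0"
    using assms by (intro act_root_nonneg) auto
  ultimately show ?thesis
    by simp
qed

section \<open>The image of the Solomon homomorphism\<close>

text \<open>
  The coefficient of \<open>w\<close> applied to the root of \<open>s\<close> at \<open>s\<close> itself is \<open>1\<close>, so this root is not negative.
\<close>

lemma len_mult_outside_parabolic:
  assumes "J \<subseteq> S" "w \<in> generate W J" "s \<in> S - J"
  shows "len (w \<otimes> s) > len w"
proof (rule ccontr)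
  have w: "w \<in> carrier W"
    using assms generate_carrier by blast
  assume "\<not> len (w \<otimes> s) > len w"
  then have "act w (simple_root s) s \<le> 0"
    using len_mult_gen[of w s] w assms by (intro act_root_nonpos) auto
  then show False
    using act_outside[OF assms(1,2), of s "simple_root s"] assms(3) by (simp add: simple_root_def)
qed

text \<open>
  Maximal length in \<open>W_J\<close> makes every element of \<open>J\<close> a descent, and by the previous lemma no other generator can be one.
\<close>

lemma longest_element:
  assumes "J \<subseteq> S"
  obtains w where "w \<in> generate W J" "\<And>s. s \<in> S \<Longrightarrow> len (w \<otimes> s) > len w \<longleftrightarrow> s \<notin> J"
proof -
  let ?A = "len ` generate W J"
  have fin: "finite ?A"
    using finite_generate[OF assms] by simp
  have "?A \<noteq> {}"
    using generate.one[of W J] by blast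
  then obtain w where w: "w \<in> generate W J" "len w = Max ?A"
    using Max_in[OF fin] by (metis imageE)
  have "\<not> len (w \<otimes> s) > len w" if "s \<in> J" for s
  proof -
    have "w \<otimes> s \<in> generate W J"
      using w that by (blast intro: generate.eng generate.incl)
    then show ?thesis
      using w fin by (simp add: leD)
  qed
  then have "len (w \<otimes> s) > len w \<longleftrightarrow> s \<notin> J" if "s \<in> S" for s
    using that len_mult_outside_parabolic[OF assms w(1)] by blast
  then show ?thesis
    by (rule that[OF w(1)])
qed

text \<open>
  At the longest element of \<open>W_{S - I}\<close>, exactly the \<open>x_K\<close> with \<open>K \<subseteq> I\<close> have coefficient \<open>1\<close>. The system of
  equations for the coefficients is thus triangular with respect to inclusion.
\<close>

lemma x_comb_inj:
  assumes eq: "x_comb W S c = x_comb W S c'" and "I \<subseteq> S"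
  shows "c I = c' I"
  using assms(2)
proof (induction "card I" arbitrary: I rule: less_induct)
  case less
  obtain w where w: "w \<in> generate W (S - I)"
    and asc: "\<And>s. s \<in> S \<Longrightarrow> len (w \<otimes> s) > len w \<longleftrightarrow> s \<notin> S - I"
    using longest_element[of "S - I"] by blast
  have finI: "finite I"
    using less.prems finite_sub_gens by blast
  have "x_comb W S d w = d I + (\<Sum>K\<in>Pow I - {I}. d K)" for d
  proof -
    have "w \<in> X_set W S K \<longleftrightarrow> K \<subseteq> I" if "K \<subseteq> S" for K
      using that asc less.prems generate_carrier[OF _ w] unfolding X_set_def by blast
    then have "x_comb W S d w = (\<Sum>K\<in>Pow S. if K \<in> Pow I then d K else 0)"
      unfolding x_comb_def x_elt_def by (intro sum.cong) (auto simp: indicator_def)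
    also have "\<dots> = (\<Sum>K\<in>Pow I. d K)"
      using less.prems by (intro sum.mono_neutral_cong_right) auto
    also have "\<dots> = d I + (\<Sum>K\<in>Pow I - {I}. d K)"
      using finI by (intro sum.remove) auto
    finally show ?thesis .
  qed
  moreover have "(\<Sum>K\<in>Pow I - {I}. c K) = (\<Sum>K\<in>Pow I - {I}. c' K)"
    using less finI by (intro sum.cong) (auto intro!: less.hyps psubset_card_mono)
  ultimately show ?case
    using fun_cong[OF eq, of w] by simp
qed

definition perm_char :: "'a set \<Rightarrow> 'a \<Rightarrow> rat" where
  "perm_char I = induced_char W (generate W I) (\<lambda>_. 1)"

definition perm_span :: "('a \<Rightarrow> rat) set" where
  "perm_span = range (\<lambda>c g. \<Sum>I\<in>Pow S. c I * perm_char I g)"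

text \<open>
  By linear independence the chosen coordinates of an element of the descent algebra are the given ones.
\<close>

lemma solomon_hom_image: "solomon_hom W S ` descent_algebra W S = perm_span"
proof -
  have "solomon_hom W S (x_comb W S c) = (\<lambda>g. \<Sum>I\<in>Pow S. c I * perm_char I g)" for c
  proof -
    let ?d = "SOME d. x_comb W S d = x_comb W S c"
    have "x_comb W S ?d = x_comb W S c"
      by (rule someI[where P = "\<lambda>d. x_comb W S d = x_comb W S c"]) (rule HOL.refl)
    then have "?d I = c I" if "I \<in> Pow S" for I
      using that x_comb_inj by blast
    then show ?thesis
      unfolding solomon_hom_def Let_def perm_char_def by (intro ext sum.cong) simp_all
  qed
  then show ?thesis
    unfolding descent_algebra_def perm_span_def image_image by simp
qed

lemma perm_char_eq:
  assumes "g \<in> carrier W"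
  shows "perm_char I g =
    (\<Sum>x\<in>carrier W. if inv x \<otimes> g \<otimes> x \<in> generate W I then 1 else 0) / of_nat (card (generate W I))"
  using assms unfolding perm_char_def induced_char_def by simp

lemma perm_char_conj:
  assumes "g \<in> carrier W" "h \<in> carrier W"
  shows "perm_char I (h \<otimes> g \<otimes> inv h) = perm_char I g"
proof -
  have "(\<Sum>x\<in>carrier W. if inv x \<otimes> (h \<otimes> g \<otimes> inv h) \<otimes> x \<in> generate W I then 1 else 0) =
    (\<Sum>x\<in>carrier W. if inv x \<otimes> g \<otimes> x \<in> generate W I then 1 else (0 :: rat))"
    using assms
    by (intro sum.reindex_bij_witness[of _ "\<lambda>x. h \<otimes> x" "\<lambda>x. inv h \<otimes> x"])
      (auto simp: inv_mult_group m_assoc, (simp flip: m_assoc)+)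
  then show ?thesis
    using assms by (simp add: perm_char_eq)
qed

lemma perm_span_class: "perm_span \<subseteq> class_functions W"
proof
  fix f
  assume "f \<in> perm_span"
  then obtain c where f: "f = (\<lambda>g. \<Sum>I\<in>Pow S. c I * perm_char I g)"
    unfolding perm_span_def by blast
  have "perm_char I g = 0" if "g \<notin> carrier W" for I g
    using that by (simp add: perm_char_def induced_char_def)
  then show "f \<in> class_functions W"
    unfolding class_functions_def f by (auto simp: perm_char_conj intro!: sum.neutral)
qed

definition conj_to :: "'a \<Rightarrow> 'a \<Rightarrow> bool" where
  "conj_to g h \<longleftrightarrow> (\<exists>x\<in>carrier W. h = x \<otimes> g \<otimes> inv x)"

definition class_ind :: "'a \<Rightarrow> 'a \<Rightarrow> rat" where
  "class_ind g = (\<lambda>h. if conj_to g h then 1 else 0)"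

lemma conj_to_refl: "g \<in> carrier W \<Longrightarrow> conj_to g g"
  unfolding conj_to_def by (intro bexI[of _ \<one>]) auto

lemma conj_to_closed: "conj_to g h \<Longrightarrow> g \<in> carrier W \<Longrightarrow> h \<in> carrier W"
  unfolding conj_to_def by auto

lemma conj_to_sym:
  assumes "conj_to g h" "g \<in> carrier W"
  shows "conj_to h g"
proof -
  obtain x where x: "x \<in> carrier W" "h = x \<otimes> g \<otimes> inv x"
    using assms unfolding conj_to_def by blast
  have "g = inv x \<otimes> h \<otimes> inv (inv x)"
    using x assms by (simp add: m_assoc) (simp flip: m_assoc)
  then show ?thesis
    using x unfolding conj_to_def by blast
qed

lemma conj_to_trans:
  assumes "conj_to g h" "conj_to h k" "g \<in> carrier W"
  shows "conj_to g k"
proof -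
  obtain x y where x: "x \<in> carrier W" "h = x \<otimes> g \<otimes> inv x"
    and y: "y \<in> carrier W" "k = y \<otimes> h \<otimes> inv y"
    using assms unfolding conj_to_def by blast
  have "k = (y \<otimes> x) \<otimes> g \<otimes> inv (y \<otimes> x)"
    using x y assms by (simp add: inv_mult_group m_assoc)
  then show ?thesis
    using x y unfolding conj_to_def by blast
qed

lemma class_ind_class_function:
  assumes "g \<in> carrier W"
  shows "class_ind g \<in> class_functions W"
proof -
  have "conj_to g (h \<otimes> k \<otimes> inv h) \<longleftrightarrow> conj_to g k" if "k \<in> carrier W" "h \<in> carrier W" for h k
  proof -
    have "conj_to k (h \<otimes> k \<otimes> inv h)"
      using that unfolding conj_to_def by blast
    then show ?thesis
      using conj_to_trans conj_to_sym that assms by blast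
  qed
  then show ?thesis
    using assms conj_to_closed by (auto simp: class_functions_def class_ind_def)
qed

lemma conj_to_if_perm_char_eq:
  assumes "class_functions W \<subseteq> perm_span" "g \<in> carrier W" "h \<in> carrier W"
    and eq: "\<And>I. I \<subseteq> S \<Longrightarrow> perm_char I g = perm_char I h"
  shows "conj_to g h"
proof -
  have "class_ind g \<in> perm_span"
    using class_ind_class_function assms by blast
  then obtain c where c: "class_ind g = (\<lambda>g. \<Sum>I\<in>Pow S. c I * perm_char I g)"
    unfolding perm_span_def by blast
  have "class_ind g g = class_ind g h"
    unfolding c using eq by (intro sum.cong) auto
  then show ?thesis
    using conj_to_refl[OF assms(2)] by (auto simp: class_ind_def split: if_splits)
qed

section \<open>Elliptic elements\<close>

text \<open>
  A linear form that is nonnegative on the simple roots and vanishes exactly on those in \<open>I\<close>: a point of the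
  dual space in the face of the fundamental chamber that belongs to \<open>W_I\<close>.
\<close>

definition outer_sum :: "'a set \<Rightarrow> ('a \<Rightarrow> real) \<Rightarrow> real" where
  "outer_sum I v = (\<Sum>s\<in>S - I. v s)"

lemma outer_sum_comb: "outer_sum I (\<lambda>r. a * u r + b * v r) = a * outer_sum I u + b * outer_sum I v"
  by (simp add: outer_sum_def sum.distrib sum_distrib_left)

lemma outer_sum_root: "s \<in> S \<Longrightarrow> outer_sum I (simple_root s) = (if s \<in> I then 0 else 1)"
  by (simp add: outer_sum_def simple_root_def)

text \<open>
  If \<open>s\<close> is a right descent of \<open>w\<close>, then \<open>w\<close> makes the root of \<open>s\<close> negative; a form fixed by \<open>w\<close> is both
  nonpositive and nonnegative there, hence zero, so that \<open>s \<in> I\<close>, and \<open>w \<otimes> s\<close> is a shorter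
  element that fixes the form.
\<close>

lemma outer_sum_stabilizer:
  assumes "I \<subseteq> S" "w \<in> carrier W"
  shows "(\<forall>v. outer_sum I (act w v) = outer_sum I v) \<longleftrightarrow> w \<in> generate W I"
proof
  assume "w \<in> generate W I"
  then show "\<forall>v. outer_sum I (act w v) = outer_sum I v"
    unfolding outer_sum_def using act_outside[OF assms(1)] by (intro allI sum.cong) auto
next
  assume "\<forall>v. outer_sum I (act w v) = outer_sum I v"
  with assms(2) show "w \<in> generate W I"
  proof (induction "len w" arbitrary: w rule: less_induct)
    case less
    show ?case
    proof (cases "w = \<one>")
      case True
      then show ?thesis
        by (simp add: generate.one)
    next
      case False
      then obtain s where s: "s \<in> S" "len w = len (w \<otimes> s) + 1"
        using ex_right_descent less.prems by blast
      have "outer_sum I (act w (simple_root s)) \<le> 0"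
        unfolding outer_sum_def using act_root_nonpos[of w s] less.prems s by (intro sum_nonpos) simp
      then have "outer_sum I (simple_root s) \<le> 0"
        using less.prems by simp
      then have sI: "s \<in> I"
        using s by (simp add: outer_sum_root split: if_splits)
      have "outer_sum I (act (w \<otimes> s) v) = outer_sum I v" for v
        using less.prems s sI act_outside[OF assms(1) generate.incl[OF sI]]
        by (simp add: act_mult outer_sum_def)
      then have "w \<otimes> s \<in> generate W I"
        using less.prems s by (intro less.hyps) auto
      then have "w \<otimes> s \<otimes> s \<in> generate W I"
        using sI by (blast intro: generate.eng generate.incl)
      then show ?thesis
        using less.prems s by simp
    qed
  qed
qed

text \<open>
  For a finite Coxeter group this says that \<open>g\<close> has no eigenvalue \<open>1\<close> on the span of the simple roots in \<open>J\<close>. It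
  is phrased through the image of \<open>1 - g\<close>, on which every linear form fixed by \<open>g\<close> vanishes. The scalar \<open>d\<close> spares
  divisions when \<open>u\<close> is given explicitly.
\<close>

definition elliptic :: "'a set \<Rightarrow> 'a \<Rightarrow> bool" where
  "elliptic J g \<longleftrightarrow> g \<in> generate W J \<and>
    (\<forall>s\<in>J. \<exists>u d. d \<noteq> 0 \<and> (\<lambda>r. u r - act g u r) = (\<lambda>r. d * simple_root s r))"

lemma ellipticE:
  assumes "elliptic J g" "s \<in> J"
  obtains u d where "d \<noteq> 0" "(\<lambda>r. u r - act g u r) = (\<lambda>r. d * simple_root s r)"
proof -
  have "\<exists>u d. d \<noteq> 0 \<and> (\<lambda>r. u r - act g u r) = (\<lambda>r. d * simple_root s r)"
    using assms by (simp add: elliptic_def)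
  then show ?thesis
    using that by (elim exE conjE)
qed

lemma act_gen_eq:
  "s \<in> S \<Longrightarrow> act s v = (\<lambda>r. 1 * v r + (- 2 * bform s v) * simple_root s r)"
  using act_gen reflect_eq by simp

text \<open>
  \<open>g\<close> lies in the conjugate of \<open>W_I\<close> by \<open>x\<close> iff it fixes the translate \<open>F\<close> of the form \<open>outer_sum I\<close>. A form fixed by \<open>g\<close>
  vanishes on the image of \<open>1 - g\<close>, hence on the simple roots in \<open>J\<close> if \<open>g\<close> is elliptic; then it is fixed by
  all of \<open>W_J\<close>.
\<close>

lemma elliptic_parabolic:
  assumes "elliptic J g" "h \<in> generate W J" "J \<subseteq> S" "I \<subseteq> S" "x \<in> carrier W"
    and "inv x \<otimes> g \<otimes> x \<in> generate W I"
  shows "inv x \<otimes> h \<otimes> x \<in> generate W I"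
proof -
  define F where "F v = outer_sum I (act (inv x) v)" for v
  have g: "g \<in> carrier W" and h: "h \<in> carrier W"
    using assms generate_carrier unfolding elliptic_def by auto
  have F_comb: "F (\<lambda>r. a * u r + b * v r) = a * F u + b * F v" for a b u v
    unfolding F_def act_comb outer_sum_comb ..
  have F_g: "F (act g v) = F v" for v
  proof -
    have "inv x \<otimes> g = (inv x \<otimes> g \<otimes> x) \<otimes> inv x"
      using g assms by (simp add: m_assoc)
    then have "act (inv x) (act g v) = act (inv x \<otimes> g \<otimes> x) (act (inv x) v)"
      using g assms by (simp flip: act_mult)
    then show ?thesis
      using outer_sum_stabilizer[of I "inv x \<otimes> g \<otimes> x"] assms g unfolding F_def by simp
  qed
  have F_root: "F (simple_root s) = 0" if "s \<in> J" for s
  proof -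
    obtain u d where u: "d \<noteq> 0" "(\<lambda>r. u r - act g u r) = (\<lambda>r. d * simple_root s r)"
      using ellipticE[OF assms(1) \<open>s \<in> J\<close>] by metis
    have "F (\<lambda>r. 1 * u r + (-1) * act g u r) = F (\<lambda>r. d * simple_root s r + 0 * simple_root s r)"
      using u by simp
    then show ?thesis
      unfolding F_comb F_g using u by simp
  qed
  have F_J: "F (word_act ws v) = F v" if "set ws \<subseteq> J" for ws v
    using that
  proof (induction ws)
    case (Cons s ws)
    then show ?case
      using F_comb[of 1 "word_act ws v" "- 2 * bform s (word_act ws v)" "simple_root s"] F_root[of s]
      by (simp add: reflect_eq[of s "word_act ws v"])
  qed simp
  obtain ws where ws: "set ws \<subseteq> J" "h = wp ws"
    using assms generate_eq_words by auto
  have "outer_sum I (act (inv x \<otimes> h \<otimes> x) v) = outer_sum I v" for v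
  proof -
    have "outer_sum I (act (inv x \<otimes> h \<otimes> x) v) = F (word_act ws (act x v))"
      using assms h ws unfolding F_def by (simp add: act_mult act_wp)
    also have "\<dots> = outer_sum I (act (inv x \<otimes> x) v)"
      using F_J[OF ws(1)] assms unfolding F_def by (simp only: act_mult inv_closed)
    finally show ?thesis
      using assms by simp
  qed
  then show ?thesis
    using outer_sum_stabilizer[of I "inv x \<otimes> h \<otimes> x"] assms h by simp
qed

text \<open>
  The part of the trace that comes from the simple roots in \<open>J\<close>. For \<open>J = S\<close> it is the trace of the
  geometric representation, a class function; on \<open>W_J\<close> the two differ by a constant.
\<close>

definition local_trace :: "'a set \<Rightarrow> 'a \<Rightarrow> real" where
  "local_trace J w = (\<Sum>s\<in>J. act w (simple_root s) s)"

lemma local_trace_commute: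
  assumes "x \<in> carrier W" "y \<in> carrier W"
  shows "local_trace S (x \<otimes> y) = local_trace S (y \<otimes> x)"
proof -
  have "local_trace S (x \<otimes> y) = (\<Sum>s\<in>S. \<Sum>t\<in>S. act y (simple_root s) t * act x (simple_root t) s)"
    if xy: "x \<in> carrier W" "y \<in> carrier W" for x y
  proof -
    have "act x (act y (simple_root s)) = (\<lambda>r. \<Sum>t\<in>S. act y (simple_root s) t * act x (simple_root t) r)"
      if s: "s \<in> S" for s
    proof -
      have "act y (simple_root s) r = (\<Sum>t\<in>S. act y (simple_root s) t * simple_root t r)" for r
      proof (cases "r \<in> S")
        case True
        have "(\<Sum>t\<in>S. act y (simple_root s) t * simple_root t r) = (\<Sum>t\<in>S. if t = r then act y (simple_root s) t else 0)"
          by (intro sum.cong) (auto simp: simple_root_def)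
        then show ?thesis
          using True by simp
      next
        case False
        then have "act y (simple_root s) r = 0"
          using act_outside[of S y r] xy gens_generate s by (auto simp: simple_root_def)
        moreover have "(\<Sum>t\<in>S. act y (simple_root s) t * simple_root t r) = 0"
          using False by (intro sum.neutral) (auto simp: simple_root_def)
        ultimately show ?thesis
          by simp
      qed
      then have "act y (simple_root s) = (\<lambda>r. \<Sum>t\<in>S. act y (simple_root s) t * simple_root t r)"
        by blast
      then show ?thesis
        using act_sum[OF finite_gens, of x "act y (simple_root s)" simple_root] by simp
    qed
    then show ?thesis
      using xy by (simp add: local_trace_def act_mult)
  qed
  then show ?thesis
    using assms by (simp add: mult.commute) (rule sum.swap)
qed

lemma local_trace_conj:
  assumes "conj_to g h" "g \<in> carrier W"
  shows "local_trace S h = local_trace S g"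
proof -
  obtain x where x: "x \<in> carrier W" "h = x \<otimes> g \<otimes> inv x"
    using assms unfolding conj_to_def by blast
  then have "local_trace S h = local_trace S (inv x \<otimes> (x \<otimes> g))"
    using local_trace_commute[of "x \<otimes> g" "inv x"] assms by simp
  then show ?thesis
    using x assms by (simp flip: m_assoc)
qed

lemma local_trace_parabolic:
  assumes "J \<subseteq> S" "w \<in> generate W J"
  shows "local_trace S w = local_trace J w + real (card (S - J))"
proof -
  have "local_trace S w = local_trace (S - J) w + local_trace J w"
    unfolding local_trace_def using assms by (intro sum.subset_diff) auto
  moreover have "local_trace (S - J) w = (\<Sum>s\<in>S - J. 1)"
    unfolding local_trace_def using act_outside[OF assms] by (intro sum.cong) (auto simp: simple_root_def)
  ultimately show ?thesis
    by simp
qed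

text \<open>
  The criterion by which labels above \<open>3\<close> and branches are excluded.
\<close>

lemma elliptic_local_trace_eq:
  assumes "class_functions W \<subseteq> perm_span" "J \<subseteq> S" "elliptic J g" "elliptic J h"
  shows "local_trace J g = local_trace J h"
proof -
  have gh: "g \<in> generate W J" "h \<in> generate W J"
    using assms by (auto simp: elliptic_def)
  then have car: "g \<in> carrier W" "h \<in> carrier W"
    using generate_carrier assms by auto
  have "perm_char I g = perm_char I h" if "I \<subseteq> S" for I
  proof -
    have "inv x \<otimes> g \<otimes> x \<in> generate W I \<longleftrightarrow> inv x \<otimes> h \<otimes> x \<in> generate W I" if "x \<in> carrier W" for x
      using elliptic_parabolic[of J g h I x] elliptic_parabolic[of J h g I x] assms gh that \<open>I \<subseteq> S\<close> by blast
    then show ?thesis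
      using car by (simp add: perm_char_eq cong: sum.cong)
  qed
  then have "conj_to g h"
    using conj_to_if_perm_char_eq assms car by blast
  then show ?thesis
    using local_trace_conj[of g h] local_trace_parabolic[OF assms(2)] gh car by simp
qed

text \<open>
  The image of \<open>1 - g\<^sup>2 = (1 - g) (1 + g)\<close> is contained in that of \<open>1 - g\<close>; the next lemma uses the
  factor \<open>1 + g + g\<^sup>2\<close> in the same way.
\<close>

lemma elliptic_of_square:
  assumes "g \<in> generate W J" "J \<subseteq> S" "elliptic J (g \<otimes> g)"
  shows "elliptic J g"
  unfolding elliptic_def
proof (intro conjI ballI)
  fix s
  assume "s \<in> J"
  then obtain u d where u: "d \<noteq> (0::real)" "(\<lambda>r. u r - act (g \<otimes> g) u r) = (\<lambda>r. d * simple_root s r)"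
    using ellipticE[OF assms(3)] by metis
  let ?v = "\<lambda>r. 1 * u r + 1 * act g u r"
  have "(\<lambda>r. ?v r - act g ?v r) = (\<lambda>r. u r - act (g \<otimes> g) u r)"
    unfolding act_comb using generate_carrier assms by (simp add: act_mult)
  then show "\<exists>u d. d \<noteq> 0 \<and> (\<lambda>r. u r - act g u r) = (\<lambda>r. d * simple_root s r)"
    using u by (intro exI[of _ ?v] exI[of _ d]) simp
qed (use assms in auto)

lemma elliptic_of_cube:
  assumes "g \<in> generate W J" "J \<subseteq> S" "elliptic J (g \<otimes> (g \<otimes> g))"
  shows "elliptic J g"
  unfolding elliptic_def
proof (intro conjI ballI)
  fix s
  assume "s \<in> J"
  then obtain u d where u: "d \<noteq> (0::real)" "(\<lambda>r. u r - act (g \<otimes> (g \<otimes> g)) u r) = (\<lambda>r. d * simple_root s r)"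
    using ellipticE[OF assms(3)] by metis
  let ?v = "\<lambda>r. 1 * u r + 1 * (1 * act g u r + 1 * act g (act g u) r)"
  have "(\<lambda>r. ?v r - act g ?v r) = (\<lambda>r. u r - act (g \<otimes> (g \<otimes> g)) u r)"
    unfolding act_comb using generate_carrier assms by (simp add: act_mult)
  then show "\<exists>u d. d \<noteq> 0 \<and> (\<lambda>r. u r - act g u r) = (\<lambda>r. d * simple_root s r)"
    using u by (intro exI[of _ ?v] exI[of _ d]) simp
qed (use assms in auto)

section \<open>Labels, branches and cycles\<close>

lemma plane_at: "s \<noteq> t \<Longrightarrow> plane s t a b s = a" "s \<noteq> t \<Longrightarrow> plane s t a b t = b"
  by (auto simp: plane_def simple_root_def)

text \<open>
  With \<open>c = 2 cos (pi / m)\<close>, the rotation \<open>s t\<close> has trace \<open>\<tau> = c\<^sup>2 - 2\<close> and determinant \<open>1\<close> in the plane, and its square has trace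
  \<open>\<tau>\<^sup>2 - 2\<close>. Both are elliptic for \<open>m \<ge> 3\<close>, so surjectivity forces \<open>\<tau> = 2\<close> or \<open>\<tau> = -1\<close>, that is, \<open>c\<^sup>2 = 4\<close> or
  \<open>c\<^sup>2 = 1\<close>, whereas \<open>2 \<le> c\<^sup>2 < 4\<close> for \<open>m \<ge> 4\<close>.
\<close>

lemma label_le_3:
  assumes surj: "class_functions W \<subseteq> perm_span" and st: "s \<in> S" "t \<in> S" "s \<noteq> t"
  shows "m s t \<le> 3"
proof (rule ccontr)
  assume "\<not> m s t \<le> 3"
  then have m4: "m s t \<ge> 4"
    by simp
  define c where "c = 2 * cos (pi / real (m s t))"
  have "cos (pi / real (m s t)) \<ge> cos (pi / 4)"
    using m4 by (intro cos_monotone_0_pi_le) (auto simp: field_simps)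
  then have c2: "c \<ge> sqrt 2"
    by (simp add: c_def cos_45)
  then have cpos: "c > 0" and csq: "c * c \<ge> 2"
    using mult_mono[OF c2 c2] by (auto intro: less_le_trans[OF _ c2])
  have "c * c < 4"
  proof -
    have "(sin (pi / real (m s t)))\<^sup>2 > 0"
      using sin_pi_div_pos[of "m s t"] m4 by simp
    then show ?thesis
      using sin_cos_squared_add[of "pi / real (m s t)"] by (simp add: c_def power2_eq_square)
  qed
  then have d: "c * (4 - c * c) \<noteq> 0"
    using cpos by simp
  let ?J = "{s, t}" and ?g = "s \<otimes> t"
  have P: "act ?g (plane s t a b) = plane s t (c * (c * a - b) - a) (c * a - b)" for a b
    using st reflect_plane[of s t a b] reflect_plane[of t s "c * a - b" a] m_sym[of t s]
    by (simp add: act_mult act_gen plane_swap[of t s] flip: c_def)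
  have P2: "act (?g \<otimes> ?g) (plane s t a b) = act ?g (act ?g (plane s t a b))" for a b
    using st by (simp add: act_mult)
  have g: "?g \<in> generate W ?J"
    by (intro generate.eng generate.incl) auto
  have roots: "simple_root s = plane s t 1 0" "simple_root t = plane s t 0 1"
    by (simp_all add: plane_def)
  have diff: "(\<lambda>r. plane s t a b r - plane s t a' b' r) = plane s t (a - a') (b - b')" for a b a' b'
    by (auto simp: plane_def algebra_simps)
  have scale: "(\<lambda>r. x * plane s t a b r) = plane s t (x * a) (x * b)" for x a b
    by (auto simp: plane_def algebra_simps)
  \<comment> \<open>The preimages used here are the columns of the adjugate of \<open>1 - (s t)\<^sup>2\<close>, divided by \<open>c\<close>.\<close>
  have ell: "elliptic ?J (?g \<otimes> ?g)"
    unfolding elliptic_def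
  proof (intro conjI ballI)
    fix r
    assume "r \<in> ?J"
    then consider "r = s" | "r = t"
      by blast
    then show "\<exists>u d. d \<noteq> 0 \<and> (\<lambda>q. u q - act (?g \<otimes> ?g) u q) = (\<lambda>q. d * simple_root r q)"
    proof cases
      case 1
      show ?thesis
        unfolding 1
        by (intro exI[of _ "plane s t c (c * c - 2)"] exI[of _ "c * (4 - c * c)"] conjI d,
            unfold roots P2 P diff scale)
          (simp add: algebra_simps)
    next
      case 2
      show ?thesis
        unfolding 2
        by (intro exI[of _ "plane s t (2 - c * c) (3 * c - c * c * c)"]
            exI[of _ "c * (4 - c * c)"] conjI d,
            unfold roots P2 P diff scale)
          (simp add: algebra_simps)
    qed
  qed (use g in \<open>auto intro: generate.eng\<close>)
  have "local_trace ?J ?g = local_trace ?J (?g \<otimes> ?g)"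
    using elliptic_local_trace_eq[OF surj _ elliptic_of_square[OF g _ ell] ell] st by simp
  then have "c * c - 2 = c * c * (c * c) - 4 * (c * c) + 2"
    using st by (simp add: local_trace_def roots P P2 plane_at algebra_simps)
  then have "(c * c - 1) * (c * c - 4) = 0"
    by (simp add: algebra_simps)
  then show False
    using csq \<open>c * c < 4\<close> by simp
qed

lemma bform_add: "bform s (\<lambda>r. u r + v r) = bform s u + bform s v"
  using bform_comb[of s 1 u 1 v] by simp

lemma bform_scale: "bform s (\<lambda>r. a * v r) = a * bform s v"
  using bform_comb[of s a v 0 v] by simp

text \<open>
  In the parabolic subgroup of type \<open>D_4\<close>, the Coxeter element \<open>g = a b d z\<close> satisfies \<open>g\<^sup>3 = -1\<close> on the span of the four roots.
  Both \<open>g\<close> and \<open>g\<^sup>3\<close> are elliptic, but their traces there are \<open>-1\<close> and \<open>-4\<close>.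
\<close>

lemma no_branch:
  assumes surj: "class_functions W \<subseteq> perm_span"
    and S: "a \<in> S" "b \<in> S" "d \<in> S" "z \<in> S"
    and dist: "distinct [a, b, d, z]"
    and m3: "m z a = 3" "m z b = 3" "m z d = 3"
    and m2: "m a b = 2" "m a d = 2" "m b d = 2"
  shows False
proof -
  define q where "q A B D Z = (\<lambda>r. A * simple_root a r + B * simple_root b r + D * simple_root d r + Z * simple_root z r)"
    for A B D Z
  have cos3: "cos (pi / 3) = 1 / 2"
    by (rule cos_60)
  note ms = m3 m2 m_sym[of a z] m_sym[of b z] m_sym[of d z] m_sym[of b a] m_sym[of d a] m_sym[of d b]
  have ra: "reflect a (q A B D Z) = q (Z - A) B D Z" for A B D Z
    using S ms dist
    by (auto simp: reflect_eq q_def bform_add bform_scale bform_root cos3 fun_eq_iff algebra_simps)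
  have rb: "reflect b (q A B D Z) = q A (Z - B) D Z" for A B D Z
    using S ms dist
    by (auto simp: reflect_eq q_def bform_add bform_scale bform_root cos3 fun_eq_iff algebra_simps)
  have rd: "reflect d (q A B D Z) = q A B (Z - D) Z" for A B D Z
    using S ms dist
    by (auto simp: reflect_eq q_def bform_add bform_scale bform_root cos3 fun_eq_iff algebra_simps)
  have rz: "reflect z (q A B D Z) = q A B D (A + B + D - Z)" for A B D Z
    using S ms dist
    by (auto simp: reflect_eq q_def bform_add bform_scale bform_root cos3 fun_eq_iff algebra_simps)
  let ?J = "{a, b, d, z}" and ?g = "a \<otimes> (b \<otimes> (d \<otimes> z))"
  let ?h = "?g \<otimes> (?g \<otimes> ?g)"
  have g: "?g \<in> generate W ?J"
    by (intro generate.eng generate.incl) auto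
  have car: "?g \<in> carrier W"
    using S by simp
  have G: "act ?g (q A B D Z) = q (B + D - Z) (A + D - Z) (A + B - Z) (A + B + D - Z)" for A B D Z
    using S by (simp add: act_mult act_gen ra rb rd rz algebra_simps)
  have H: "act ?h (q A B D Z) = q (- A) (- B) (- D) (- Z)" for A B D Z
    using car by (simp add: act_mult G del: m_assoc)
  have roots: "simple_root a = q 1 0 0 0" "simple_root b = q 0 1 0 0" "simple_root d = q 0 0 1 0" "simple_root z = q 0 0 0 1"
    by (simp_all add: q_def)
  have at: "q A B D Z a = A" "q A B D Z b = B" "q A B D Z d = D" "q A B D Z z = Z" for A B D Z
    using dist by (auto simp: q_def simple_root_def)
  have ell: "elliptic ?J ?h"
    unfolding elliptic_def
  proof (intro conjI ballI)
    fix r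
    assume "r \<in> ?J"
    then obtain A B D Z where r: "simple_root r = q A B D Z"
      using roots by blast
    have "(\<lambda>x. simple_root r x - act ?h (simple_root r) x) = (\<lambda>x. 2 * simple_root r x)"
      unfolding r H by (auto simp: q_def)
    then show "\<exists>u d. d \<noteq> 0 \<and> (\<lambda>q. u q - act ?h u q) = (\<lambda>q. d * simple_root r q)"
      by (intro exI[of _ "simple_root r"] exI[of _ 2]) simp
  qed (use g in \<open>auto intro!: generate.eng\<close>)
  have "local_trace ?J ?g = local_trace ?J ?h"
    using elliptic_local_trace_eq[OF surj _ elliptic_of_cube[OF g _ ell] ell] S by simp
  moreover have "local_trace ?J ?g = -1"
    using dist by (simp add: local_trace_def roots G at)
  moreover have "local_trace ?J ?h = -4"
    using dist by (simp add: local_trace_def roots H at)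
  ultimately show False
    by simp
qed

text \<open>
  Let \<open>v\<close> be the sum of the simple roots in \<open>J\<close>. Two neighbours in \<open>J\<close> contribute at most \<open>-1/2\<close> each, so \<open>v\<close> has a
  nonpositive inner product with every simple root. Every \<open>w\<close> therefore adds nonnegative multiples of positive
  roots to \<open>v\<close>, while the longest element of \<open>W\<close> makes all simple roots, and so \<open>v\<close>, negative.
\<close>

lemma no_cycle:
  assumes J: "J \<subseteq> S" "J \<noteq> {}"
    and nbrs: "\<And>s. s \<in> J \<Longrightarrow> \<exists>t\<in>J. \<exists>u\<in>J. t \<noteq> u \<and> t \<noteq> s \<and> u \<noteq> s \<and> m s t \<ge> 3 \<and> m s u \<ge> 3"
  shows False
proof -
  define v :: "'a \<Rightarrow> real" where "v = (\<lambda>r. \<Sum>j\<in>J. 1 * simple_root j r)"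
  have finJ: "finite J"
    using J finite_sub_gens by blast
  have v_eq: "v r = (if r \<in> J then 1 else 0)" for r
    unfolding v_def simple_root_def using finJ by simp
  have cos_nonneg: "cos (pi / real n) \<ge> 0" if "n \<ge> 2" for n
    using that by (intro cos_ge_zero) (auto simp: field_simps intro: order_trans[of _ 0])
  have cos_half: "cos (pi / real n) \<ge> 1 / 2" if "n \<ge> 3" for n
  proof -
    have "cos (pi / real n) \<ge> cos (pi / 3)"
      using that by (intro cos_monotone_0_pi_le) (auto simp: field_simps)
    then show ?thesis
      by (simp add: cos_60)
  qed
  have neg: "bform s v \<le> 0" if s: "s \<in> S" for s
  proof -
    have "bform s v = (\<Sum>r\<in>S. if r \<in> J then - cos (pi / real (m s r)) else 0)"
      unfolding bform_def v_eq by (intro sum.cong) auto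
    also have "\<dots> = (\<Sum>r\<in>J. - cos (pi / real (m s r)))"
      using J by (intro sum.mono_neutral_cong_right) auto
    also have "\<dots> \<le> 0"
    proof (cases "s \<in> J")
      case False
      then show ?thesis
        using s J m_ge_2[of s] by (intro sum_nonpos) (auto intro!: cos_nonneg)
    next
      case True
      obtain t u where tu: "t \<in> J" "u \<in> J" "t \<noteq> u" "t \<noteq> s" "u \<noteq> s" "m s t \<ge> 3" "m s u \<ge> 3"
        using nbrs[OF True] by blast
      have "(\<Sum>r\<in>J. - cos (pi / real (m s r))) = (\<Sum>r\<in>{s, t, u}. - cos (pi / real (m s r))) +
          (\<Sum>r\<in>J - {s, t, u}. - cos (pi / real (m s r)))"
        using tu True finJ by (subst sum.subset_diff[of "{s, t, u}"]) auto
      also have "(\<Sum>r\<in>J - {s, t, u}. - cos (pi / real (m s r))) \<le> 0"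
        using s J m_ge_2[of s] by (intro sum_nonpos) (auto intro!: cos_nonneg)
      also have "(\<Sum>r\<in>{s, t, u}. - cos (pi / real (m s r))) \<le> 0"
        using tu s cos_half[OF tu(6)] cos_half[OF tu(7)] by simp
      finally show ?thesis
        by simp
    qed
    finally show ?thesis .
  qed
  have grow: "act w v r \<ge> v r" if "w \<in> carrier W" for w r
    using that
  proof (induction "len w" arbitrary: w r rule: less_induct)
    case less
    show ?case
    proof (cases "w = \<one>")
      case False
      then obtain s where s: "s \<in> S" "len w = len (w \<otimes> s) + 1"
        using ex_right_descent less.prems by blast
      let ?w = "w \<otimes> s"
      have car: "?w \<in> carrier W"
        using s less.prems by simp
      have "act w v = act ?w (act s v)"
        using act_mult[of ?w s v] s less.prems by simp
      then have "act w v r = act ?w v r - 2 * bform s v * act ?w (simple_root s) r"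
        using s by (simp only: act_gen_eq act_comb)
      moreover have "act ?w (simple_root s) r \<ge> 0"
        using s less.prems car by (intro act_root_nonneg) auto
      then have "bform s v * act ?w (simple_root s) r \<le> 0"
        using neg s by (intro mult_nonpos_nonneg) auto
      moreover have "act ?w v r \<ge> v r"
        using less.hyps[of ?w] s car by simp
      ultimately show ?thesis
        by linarith
    qed simp
  qed
  obtain w where w: "w \<in> generate W S" "\<And>s. s \<in> S \<Longrightarrow> len (w \<otimes> s) > len w \<longleftrightarrow> s \<notin> S"
    using longest_element[of S] by blast
  then have car: "w \<in> carrier W"
    using gens_generate by simp
  obtain j where j: "j \<in> J"
    using J by blast
  have "act w v j = (\<Sum>i\<in>J. 1 * act w (simple_root i) j)"
    unfolding v_def using act_sum[OF finJ, of w "\<lambda>_. 1" simple_root] by simp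
  also have "\<dots> \<le> 0"
  proof (rule sum_nonpos)
    fix i
    assume "i \<in> J"
    then have "i \<in> S" "len (w \<otimes> i) < len w"
      using J w(2)[of i] len_mult_gen[OF car, of i] by auto
    then show "1 * act w (simple_root i) j \<le> 0"
      using act_root_nonpos[OF car] by simp
  qed
  finally show False
    using grow[OF car, of j] j by (simp add: v_eq)
qed

text \<open>
  Two neighbours of one vertex are not adjacent to each other, as this would be a triangle; so three
  neighbours would give a branch in the sense of \<open>no_branch\<close>.
\<close>

lemma surjective_imp_type_A:
  assumes surj: "class_functions W \<subseteq> perm_span"
  shows "product_of_symmetric_groups W S"
  unfolding product_of_symmetric_groups_def irreducible_components_def
proof
  fix J
  assume J: "J \<in> S // (coxeter_graph W S)\<^sup>*"
  let ?E = "coxeter_graph W S"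
  have E: "(s, t) \<in> ?E \<longleftrightarrow> s \<in> S \<and> t \<in> S \<and> s \<noteq> t \<and> m s t = 3" for s t
    using label_le_3[OF surj, of s t] m_ge_2[of s t] unfolding coxeter_graph_def by force
  have sub: "?E \<subseteq> S \<times> S" and irr: "irrefl ?E"
    by (auto simp: coxeter_graph_def irrefl_def)
  have sym: "sym ?E"
    by (rule symI) (metis E m_sym)
  have acyc: "\<exists>x\<in>J. \<not> (\<exists>y\<in>J. \<exists>z\<in>J. y \<noteq> z \<and> (x, y) \<in> ?E \<and> (x, z) \<in> ?E)"
    if "J \<subseteq> S" "J \<noteq> {}" for J
  proof (rule ccontr)
    assume "\<not> ?thesis"
    then have "\<exists>t\<in>J. \<exists>u\<in>J. t \<noteq> u \<and> t \<noteq> s \<and> u \<noteq> s \<and> m s t \<ge> 3 \<and> m s u \<ge> 3" if "s \<in> J" for s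
      using that unfolding E by (metis order_refl)
    then show False
      using no_cycle that by blast
  qed
  have deg: "\<not> distinct [a, b, d]" if z: "(z, a) \<in> ?E" "(z, b) \<in> ?E" "(z, d) \<in> ?E" for z a b d
  proof
    assume dist: "distinct [a, b, d]"
    have S: "a \<in> S" "b \<in> S" "d \<in> S" "z \<in> S" and m3: "m z a = 3" "m z b = 3" "m z d = 3"
      and ne: "z \<noteq> a" "z \<noteq> b" "z \<noteq> d"
      using z unfolding E by auto
    have m2: "m p q = 2" if "(z, p) \<in> ?E" "(z, q) \<in> ?E" "p \<noteq> q" for p q
    proof (rule ccontr)
      assume "m p q \<noteq> 2"
      then have "(p, q) \<in> ?E"
        using that by (auto simp: coxeter_graph_def)
      then have "\<forall>x\<in>{z, p, q}. \<exists>y\<in>{z, p, q}. \<exists>w\<in>{z, p, q}. y \<noteq> w \<and> (x, y) \<in> ?E \<and> (x, w) \<in> ?E"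
        using that sym irr by (auto dest: symD simp: irrefl_def)
      moreover have "{z, p, q} \<subseteq> S"
        using that E by auto
      ultimately show False
        using acyc[of "{z, p, q}"] by blast
    qed
    have "m a b = 2" "m a d = 2" "m b d = 2"
      using m2 z dist by auto
    then show False
      using no_branch[OF surj S _ m3] dist ne by auto
  qed
  obtain ps where ps: "distinct ps" "set ps = J"
    "\<And>i j. i < j \<Longrightarrow> j < length ps \<Longrightarrow> (ps ! i, ps ! j) \<in> ?E \<longleftrightarrow> j = i + 1"
  proof (rule component_is_path[OF finite_gens sub sym irr _ _ J], goal_cases)
    case (1 J)
    from 1(2,3) show ?case
      by (rule acyc)
  next
    case (2 x y1 y2 y3)
    from 2(2-4) show ?case
      by (rule deg)
  next
    case (3 ps)
    from 3(2-4) show ?case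
      by (rule that)
  qed
  have JS: "J \<subseteq> S"
    using component_subset[OF sub J] .
  have "J \<noteq> {}"
    using J by (auto simp: quotient_def)
  then have len: "length ps \<ge> 1"
    using ps by (cases ps) auto
  let ?s = "\<lambda>i. ps ! (i - 1)"
  have "bij_betw ?s {1..length ps} J"
  proof -
    have "bij_betw ((!) ps) {..<length ps} (set ps)"
      using ps by (intro bij_betw_nth) auto
    moreover have "bij_betw (\<lambda>i. i - 1) {1..length ps} {..<length ps}"
      by (rule bij_betw_byWitness[where f' = Suc]) auto
    ultimately have "bij_betw ((!) ps \<circ> (\<lambda>i. i - 1)) {1..length ps} (set ps)"
      by (rule bij_betw_trans[rotated])
    then show ?thesis
      using ps(2) by (simp add: comp_def)
  qed
  moreover have "m (?s i) (?s j) = (if j = i + 1 then 3 else 2)"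
    if "i \<in> {1..length ps}" "j \<in> {1..length ps}" "i < j" for i j
  proof -
    have ij: "i - 1 < j - 1" "j - 1 < length ps"
      using that by auto
    have "ps ! (i - 1) \<in> S" "ps ! (j - 1) \<in> S" "ps ! (i - 1) \<noteq> ps ! (j - 1)"
      using ij ps JS nth_mem[of "i - 1" ps] nth_mem[of "j - 1" ps]
      by (auto simp: nth_eq_iff_index_eq)
    moreover have "(ps ! (i - 1), ps ! (j - 1)) \<in> ?E \<longleftrightarrow> j = i + 1"
      using ps(3)[OF ij] that by auto
    ultimately show ?thesis
      using E[of "?s i" "?s j"] by (auto simp: coxeter_graph_def)
  qed
  ultimately show "\<exists>n\<ge>1. type_A W J n"
    unfolding type_A_def using len by (intro exI[of _ "length ps"] conjI exI[of _ ?s]) auto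
qed

section \<open>Products of symmetric groups\<close>

text \<open>
  Generators in the order of a disjoint union of paths, each path traversed from one end to the other: only
  consecutive ones may fail to commute.
\<close>

primrec path_ordered :: "'a list \<Rightarrow> bool" where
  "path_ordered [] \<longleftrightarrow> True"
| "path_ordered (s # ss) \<longleftrightarrow>
    (\<forall>t\<in>set ss. m s t \<in> {2, 3}) \<and> (\<forall>t\<in>set (tl ss). m s t = 2) \<and> path_ordered ss"

lemma set_tl: "x \<in> set (tl xs) \<Longrightarrow> x \<in> set xs"
  by (cases xs) auto

lemma path_ordered_filter: "path_ordered ss \<Longrightarrow> path_ordered (filter P ss)"
proof (induction ss)
  case (Cons s ss)
  have "set (tl (filter P ss)) \<subseteq> set (tl ss)"
    by (cases ss) (auto dest: set_tl split: if_splits)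
  then show ?case
    using Cons by auto
qed simp

lemma path_ordered_append:
  "path_ordered xs \<Longrightarrow> path_ordered ys \<Longrightarrow> (\<And>x y. x \<in> set xs \<Longrightarrow> y \<in> set ys \<Longrightarrow> m x y = 2) \<Longrightarrow> path_ordered (xs @ ys)"
proof (induction xs)
  case (Cons x xs)
  have "set (tl (xs @ ys)) \<subseteq> set (tl xs) \<union> set ys"
    by (cases xs) (auto dest: set_tl)
  then show ?case
    using Cons by auto
qed simp

lemma path_ordered_nth:
  assumes "\<And>i j. i < j \<Longrightarrow> j < length ps \<Longrightarrow> m (ps ! i) (ps ! j) = (if j = i + 1 then 3 else 2)"
  shows "path_ordered ps"
  using assms
proof (induction ps)
  case (Cons s ss)
  have "m s t \<in> {2, 3}" if "t \<in> set ss" for t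
  proof -
    obtain j where "j < length ss" "t = ss ! j"
      using \<open>t \<in> set ss\<close> by (auto simp: in_set_conv_nth)
    then show ?thesis
      using Cons.prems[of 0 "Suc j"] by auto
  qed
  moreover have "m s t = 2" if "t \<in> set (tl ss)" for t
  proof -
    obtain j where "j < length (tl ss)" "t = tl ss ! j"
      using \<open>t \<in> set (tl ss)\<close> by (auto simp: in_set_conv_nth)
    then show ?thesis
      using Cons.prems[of 0 "Suc (Suc j)"] by (auto simp: nth_tl)
  qed
  moreover have "path_ordered ss"
  proof (rule Cons.IH)
    fix i j
    assume "i < j" "j < length ss"
    then show "m (ss ! i) (ss ! j) = (if j = i + 1 then 3 else 2)"
      using Cons.prems[of "Suc i" "Suc j"] by simp
  qed
  ultimately show ?case
    by simp
qed simp

text \<open>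
  Generators in different components commute, so the paths can be concatenated in any order.
\<close>

lemma path_ordering:
  assumes "product_of_symmetric_groups W S"
  obtains ss where "path_ordered ss" "set ss = S"
proof -
  let ?E = "coxeter_graph W S"
  let ?C = "S // ?E\<^sup>*"
  have sub: "?E \<subseteq> S \<times> S"
    by (auto simp: coxeter_graph_def)
  have sym: "sym ?E"
    by (rule symI) (auto simp: coxeter_graph_def m_sym)
  have single: "\<exists>ps. path_ordered ps \<and> set ps = J" if "J \<in> ?C" for J
  proof -
    have "\<exists>n\<ge>1. type_A W J n"
      using assms that by (simp add: product_of_symmetric_groups_def irreducible_components_def)
    then obtain n where "type_A W J n"
      by blast
    then obtain f where f: "bij_betw f {1..n} J"
      "\<And>i j. i \<in> {1..n} \<Longrightarrow> j \<in> {1..n} \<Longrightarrow> i < j \<Longrightarrow> m (f i) (f j) = (if j = i + 1 then 3 else 2)"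
      unfolding type_A_def by metis
    let ?ps = "map f [1..<Suc n]"
    have "path_ordered ?ps"
    proof (rule path_ordered_nth)
      fix i j
      assume "i < j" "j < length ?ps"
      then show "m (?ps ! i) (?ps ! j) = (if j = i + 1 then 3 else 2)"
        using f(2)[of "Suc i" "Suc j"] by (simp del: upt_Suc)
    qed
    moreover have "set ?ps = J"
      using f(1) by (auto simp: bij_betw_def simp del: upt_Suc)
    ultimately show ?thesis
      by blast
  qed
  have apart: "m x y = 2" if "J \<in> ?C" "K \<in> ?C" "J \<noteq> K" "x \<in> J" "y \<in> K" for J K x y
  proof (rule ccontr)
    assume "m x y \<noteq> 2"
    have "x \<in> S" "y \<in> S"
      using that component_subset[OF sub] by blast+
    then have xy: "(x, y) \<in> ?E\<^sup>*"
      using \<open>m x y \<noteq> 2\<close> by (cases "x = y") (auto simp: coxeter_graph_def)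
    obtain a where a: "J = ?E\<^sup>* `` {a}"
      using \<open>J \<in> ?C\<close> by (auto elim: quotientE)
    obtain b where b: "K = ?E\<^sup>* `` {b}"
      using \<open>K \<in> ?C\<close> by (auto elim: quotientE)
    note ab = a b
    have symE: "(v, u) \<in> ?E\<^sup>*" if "(u, v) \<in> ?E\<^sup>*" for u v
      using that sym_rtrancl[OF sym] by (auto dest: symD)
    have "(a, b) \<in> ?E\<^sup>*"
      using that ab xy symE[of b y] by (auto intro: rtrancl_trans)
    then have "J = K"
      using ab symE[of a b] by (auto intro: rtrancl_trans)
    then show False
      using that by simp
  qed
  have "finite ?C"
    by (simp add: quotient_def)
  have "\<exists>ss. path_ordered ss \<and> set ss = \<Union>A" if "A \<subseteq> ?C" for A
    using finite_subset[OF that \<open>finite ?C\<close>] that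
  proof (induction A)
    case empty
    show ?case
      by (intro exI[of _ "[]"]) simp
  next
    case (insert J A)
    obtain ss where ss: "path_ordered ss" "set ss = \<Union>A"
      using insert by auto
    obtain ps where ps: "path_ordered ps" "set ps = J"
      using insert single by auto
    have "path_ordered (ps @ ss)"
    proof (rule path_ordered_append[OF ps(1) ss(1)])
      fix x y
      assume "x \<in> set ps" "y \<in> set ss"
      then obtain K where "x \<in> J" "y \<in> K" "K \<in> A"
        using ps ss by auto
      then show "m x y = 2"
        using apart[of J K x y] insert by auto
    qed
    then show ?case
      using ps ss by (intro exI[of _ "ps @ ss"]) simp
  qed
  from this[of ?C] obtain ss where "path_ordered ss" "set ss = \<Union>?C"
    by auto
  moreover have "\<Union>?C = S"
    using component_subset[OF sub] by (auto simp: quotient_def)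
  ultimately show ?thesis
    using that by simp
qed

lemma commute_generate:
  assumes "x \<in> carrier W" "J \<subseteq> S" "\<And>t. t \<in> J \<Longrightarrow> x \<otimes> t = t \<otimes> x" "u \<in> generate W J"
  shows "x \<otimes> u = u \<otimes> x"
  using assms(4)
proof induction
  case (inv h)
  then show ?case
    using assms by (auto simp: subset_iff)
next
  case (eng u v)
  have "u \<in> carrier W" "v \<in> carrier W"
    using eng generate_carrier[OF assms(2)] by auto
  then show ?case
    using eng.IH assms(1) by (metis m_assoc)
qed (use assms in auto)

definition two_cosets :: "'a \<Rightarrow> 'a set \<Rightarrow> 'a set" where
  "two_cosets s J = generate W J \<union> {a \<otimes> s \<otimes> b |a b. a \<in> generate W J \<and> b \<in> generate W J}"

lemma two_cosets_mult:
  assumes "s \<in> S" "J \<subseteq> S" "a \<in> generate W J" "y \<in> two_cosets s J"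
  shows "a \<otimes> y \<in> two_cosets s J" "y \<otimes> a \<in> two_cosets s J"
proof -
  have a: "a \<in> carrier W"
    using assms generate_carrier by blast
  have "a \<otimes> y \<in> two_cosets s J \<and> y \<otimes> a \<in> two_cosets s J"
  proof (cases "y \<in> generate W J")
    case True
    then show ?thesis
      using assms generate.eng[of _ W J] unfolding two_cosets_def by blast
  next
    case False
    then obtain c d where cd: "y = c \<otimes> s \<otimes> d" "c \<in> generate W J" "d \<in> generate W J"
      using assms unfolding two_cosets_def by blast
    then have "c \<in> carrier W" "d \<in> carrier W"
      using assms generate_carrier by auto
    then have "a \<otimes> y = (a \<otimes> c) \<otimes> s \<otimes> d" "y \<otimes> a = c \<otimes> s \<otimes> (d \<otimes> a)"
      using cd a assms by (simp_all add: m_assoc)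
    moreover have "a \<otimes> c \<in> generate W J" "d \<otimes> a \<in> generate W J"
      using cd assms by (auto intro: generate.eng)
    ultimately show ?thesis
      using cd unfolding two_cosets_def by blast
  qed
  then show "a \<otimes> y \<in> two_cosets s J" "y \<otimes> a \<in> two_cosets s J"
    by auto
qed

text \<open>
  It suffices that \<open>s u s\<close> stays in the union for \<open>u\<close> in the smaller parabolic subgroup. By induction \<open>u\<close> lies in
  \<open>H\<close> or in \<open>H t H\<close>, where \<open>t\<close> is the next generator and \<open>H\<close> commutes with \<open>s\<close>, so that only \<open>s t s\<close> has to be
  rewritten: it is \<open>t\<close> or \<open>t s t\<close>.
\<close>

lemma ordered_double_cosets:
  assumes "path_ordered (s # ss)" "set (s # ss) \<subseteq> S"
  shows "generate W (set (s # ss)) \<subseteq> two_cosets s (set ss)"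
  using assms
proof (induction ss arbitrary: s)
  case Nil
  have sq: "s \<otimes> y \<in> two_cosets s {}" if "y \<in> two_cosets s {}" for y
    using that Nil by (auto simp: two_cosets_def generate_empty)
  have "wp ws \<in> two_cosets s {}" if "set ws \<subseteq> {s}" for ws
    using that by (induction ws) (auto simp: sq, simp add: two_cosets_def generate.one)
  then show ?case
    using generate_eq_words[of "{s}"] Nil by auto
next
  case (Cons t ss)
  have S: "s \<in> S" "t \<in> S" "set ss \<subseteq> S" "set (t # ss) \<subseteq> S"
    using Cons.prems by auto
  let ?G = "generate W (set (t # ss))" and ?H = "generate W (set ss)"
  let ?D = "two_cosets s (set (t # ss))"
  have IH: "?G \<subseteq> two_cosets t (set ss)"
    using Cons by simp
  have HG: "?H \<subseteq> ?G"
    by (intro mono_generate) auto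
  have tG: "t \<in> ?G"
    by (rule generate.incl) simp
  have sH: "s \<otimes> u = u \<otimes> s" if "u \<in> ?H" for u
    using commute_generate[OF _ S(3) _ that, of s] commute_if_m_2[of s] S Cons.prems(1) by auto
  have conj: "s \<otimes> u \<otimes> s \<in> ?D" if u: "u \<in> ?G" for u
  proof (cases "u \<in> ?H")
    case True
    then have "s \<otimes> u \<otimes> s = u"
      using sH[of u] S generate_carrier[of "set ss"] by simp
    then show ?thesis
      using u by (simp add: two_cosets_def)
  next
    case False
    then obtain a b where ab: "u = a \<otimes> t \<otimes> b" "a \<in> ?H" "b \<in> ?H"
      using u IH unfolding two_cosets_def by blast
    then have car: "a \<in> carrier W" "b \<in> carrier W"
      using S generate_carrier by auto
    have abG: "a \<in> ?G" "b \<in> ?G"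
      using ab HG by auto
    have "s \<otimes> u \<otimes> s = (s \<otimes> a) \<otimes> t \<otimes> (b \<otimes> s)"
      using ab car S by (simp add: m_assoc)
    also have "\<dots> = a \<otimes> (s \<otimes> t \<otimes> s) \<otimes> b"
      using sH[of a] sH[of b, symmetric] ab car S by (simp add: m_assoc)
    finally have eq: "s \<otimes> u \<otimes> s = a \<otimes> (s \<otimes> t \<otimes> s) \<otimes> b" .
    have "m s t = 2 \<or> m s t = 3"
      using Cons.prems by auto
    then show ?thesis
    proof
      assume "m s t = 2"
      then have "s \<otimes> t \<otimes> s = t"
        using commute_if_m_2[of s t] S by simp
      then show ?thesis
        using eq u ab(1) by (simp add: two_cosets_def)
    next
      assume "m s t = 3"
      then have "s \<otimes> u \<otimes> s = a \<otimes> (t \<otimes> s \<otimes> t) \<otimes> b"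
        unfolding eq using braid_if_m_3[of s t] S by simp
      then have "s \<otimes> u \<otimes> s = (a \<otimes> t) \<otimes> s \<otimes> (t \<otimes> b)"
        using S car by (simp add: m_assoc)
      moreover have "a \<otimes> t \<in> ?G" "t \<otimes> b \<in> ?G"
        using abG tG by (auto intro: generate.eng)
      ultimately show ?thesis
        unfolding two_cosets_def by blast
    qed
  qed
  have left: "s \<otimes> y \<in> ?D" if y: "y \<in> ?D" for y
  proof (cases "y \<in> ?G")
    case True
    then have "s \<otimes> y = \<one> \<otimes> s \<otimes> y"
      using S by simp
    then show ?thesis
      using True generate.one[of W "set (t # ss)"] unfolding two_cosets_def by blast
  next
    case False
    then obtain a b where ab: "y = a \<otimes> s \<otimes> b" "a \<in> ?G" "b \<in> ?G"
      using y unfolding two_cosets_def by blast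
    then have "s \<otimes> y = (s \<otimes> a \<otimes> s) \<otimes> b"
      using S generate_carrier[OF S(4)] by (simp add: m_assoc)
    then show ?thesis
      using two_cosets_mult(2)[OF S(1,4) ab(3) conj[OF ab(2)]] by simp
  qed
  have "wp ws \<in> ?D" if "set ws \<subseteq> set (s # t # ss)" for ws
    using that
  proof (induction ws)
    case Nil
    show ?case
      by (simp add: two_cosets_def generate.one)
  next
    case (Cons r ws)
    then have IH: "wp ws \<in> ?D"
      by simp
    show ?case
    proof (cases "r = s")
      case True
      then show ?thesis
        using left[OF IH] by simp
    next
      case False
      then have "r \<in> ?G"
        using Cons.prems by (intro generate.incl) auto
      then show ?thesis
        using two_cosets_mult(1)[OF S(1,4) _ IH] by simp
    qed
  qed
  then show ?case
    using generate_eq_words[OF Cons.prems(2)] by auto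
qed

text \<open>
  The last generator of the list comes first, because the inductions add generators at the head of the list.
\<close>

definition coxeter_elt :: "'a list \<Rightarrow> 'a set \<Rightarrow> 'a" where
  "coxeter_elt ss K = wp (filter (\<lambda>s. s \<in> K) (rev ss))"

lemma conj_mult:
  assumes "x \<in> carrier W" "b \<in> carrier W" "q \<in> carrier W" "a \<in> carrier W" "s \<in> carrier W" "b \<otimes> q = q \<otimes> b"
  shows "(x \<otimes> b) \<otimes> ((a \<otimes> s \<otimes> b) \<otimes> q) \<otimes> inv (x \<otimes> b) = x \<otimes> ((b \<otimes> a) \<otimes> (s \<otimes> q)) \<otimes> inv x"
proof -
  note car = assms(1-5)
  have "a \<otimes> s \<otimes> b \<otimes> q = a \<otimes> s \<otimes> (b \<otimes> q)"
    using car by (simp add: m_assoc)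
  also have "\<dots> = a \<otimes> s \<otimes> (q \<otimes> b)"
    by (simp only: assms(6))
  finally have "(x \<otimes> b) \<otimes> ((a \<otimes> s \<otimes> b) \<otimes> q) \<otimes> inv (x \<otimes> b) =
      (x \<otimes> b) \<otimes> (a \<otimes> s \<otimes> (q \<otimes> b)) \<otimes> inv (x \<otimes> b)"
    by simp
  moreover have "b \<otimes> (inv b \<otimes> inv x) = inv x"
    using car by (simp flip: m_assoc)
  ultimately show ?thesis
    using car by (simp add: m_assoc inv_mult_group)
qed

text \<open>
  The factor \<open>q\<close> collects the generators already split off. If \<open>y = a s b\<close>, then \<open>b\<close> commutes with \<open>q\<close>, and conjugation by \<open>b\<close>
  turns \<open>y q\<close> into \<open>(b a) (s q)\<close> with \<open>b a\<close> in the smaller parabolic subgroup. The conjugating element is kept in the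
  parabolic subgroup of the list; so the one that the induction gives for the tail commutes with \<open>q\<close>, as the case without \<open>s\<close> requires.
\<close>

lemma conj_to_coxeter_elt_aux:
  assumes "path_ordered ss" "set ss \<subseteq> S" "y \<in> generate W (set ss)" "q \<in> carrier W"
    "\<And>t. t \<in> set (tl ss) \<Longrightarrow> q \<otimes> t = t \<otimes> q"
  shows "\<exists>K\<subseteq>set ss. \<exists>x\<in>generate W (set ss). x \<otimes> (y \<otimes> q) \<otimes> inv x = coxeter_elt ss K \<otimes> q"
  using assms
proof (induction ss arbitrary: y q)
  case Nil
  then show ?case
    by (auto simp: coxeter_elt_def generate_empty)
next
  case (Cons s ss)
  let ?G = "generate W (set ss)"
  have S: "s \<in> S" "set ss \<subseteq> S"
    using Cons.prems by auto
  have s: "s \<notin> set ss"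
    using Cons.prems(1) S by auto
  have GG: "?G \<subseteq> generate W (set (s # ss))"
    by (intro mono_generate) auto
  have qG: "q \<otimes> u = u \<otimes> q" if "u \<in> ?G" for u
    using commute_generate[OF Cons.prems(4) S(2) _ that] Cons.prems(5) by simp
  have wpf: "wp (filter P (rev ss)) \<in> carrier W" for P
    using S by (intro wp_closed) auto
  have "y \<in> two_cosets s (set ss)"
    using ordered_double_cosets[OF Cons.prems(1,2)] Cons.prems(3) by blast
  then consider "y \<in> ?G" | a b where "y = a \<otimes> s \<otimes> b" "a \<in> ?G" "b \<in> ?G"
    unfolding two_cosets_def by blast
  then show ?case
  proof cases
    case 1
    have "\<exists>K\<subseteq>set ss. \<exists>x\<in>?G. x \<otimes> (y \<otimes> \<one>) \<otimes> inv x = coxeter_elt ss K \<otimes> \<one>"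
      by (rule Cons.IH[OF _ S(2) 1 one_closed]) (use Cons.prems(1) S(2) in \<open>auto dest!: set_tl\<close>)
    then obtain K x where K: "K \<subseteq> set ss" "x \<in> ?G" "x \<otimes> (y \<otimes> \<one>) \<otimes> inv x = coxeter_elt ss K \<otimes> \<one>"
      by blast
    have car: "x \<in> carrier W" "y \<in> carrier W" "q \<in> carrier W"
      using K 1 S generate_carrier Cons.prems by auto
    have xi: "inv x \<in> ?G"
      using subgroup.m_inv_closed[OF subgroup_generate[OF S(2)] K(2)] .
    have "x \<otimes> (y \<otimes> q) \<otimes> inv x = x \<otimes> y \<otimes> (q \<otimes> inv x)"
      using car by (simp add: m_assoc)
    also have "\<dots> = (x \<otimes> (y \<otimes> \<one>) \<otimes> inv x) \<otimes> q"
      using qG[OF xi] car by (simp add: m_assoc)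
    also have "\<dots> = coxeter_elt (s # ss) K \<otimes> q"
      unfolding K(3) using K(1) s S wpf by (auto simp: coxeter_elt_def)
    finally show ?thesis
      using K GG by auto
  next
    case 2
    have car: "a \<in> carrier W" "b \<in> carrier W" "q \<in> carrier W" "s \<in> carrier W"
      using 2 S generate_carrier Cons.prems by auto
    have comm: "(s \<otimes> q) \<otimes> t = t \<otimes> (s \<otimes> q)" if t: "t \<in> set (tl ss)" for t
    proof -
      have "t \<in> set ss"
        using t by (rule set_tl)
      then have "t \<in> S" "q \<otimes> t = t \<otimes> q" "s \<otimes> t = t \<otimes> s"
        using Cons.prems(1,5) S t commute_if_m_2[of s t] by auto
      then show ?thesis
        using car by (metis gen_carrier m_assoc)
    qed
    have "\<exists>K\<subseteq>set ss. \<exists>x\<in>?G.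
      x \<otimes> ((b \<otimes> a) \<otimes> (s \<otimes> q)) \<otimes> inv x = coxeter_elt ss K \<otimes> (s \<otimes> q)"
      by (rule Cons.IH[OF _ S(2) _ _ comm])
        (use 2 Cons.prems(1) car in \<open>auto intro: generate.eng\<close>)
    then obtain K x where K: "K \<subseteq> set ss" "x \<in> ?G"
      "x \<otimes> ((b \<otimes> a) \<otimes> (s \<otimes> q)) \<otimes> inv x = coxeter_elt ss K \<otimes> (s \<otimes> q)"
      by blast
    have "x \<in> carrier W"
      using K S generate_carrier by auto
    then have "(x \<otimes> b) \<otimes> (y \<otimes> q) \<otimes> inv (x \<otimes> b) = coxeter_elt ss K \<otimes> (s \<otimes> q)"
      unfolding 2(1) using conj_mult car qG[OF 2(3)] K(3) by simp
    also have "\<dots> = coxeter_elt (s # ss) (insert s K) \<otimes> q"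
    proof -
      have "filter (\<lambda>r. r = s \<or> r \<in> K) (rev ss) = filter (\<lambda>r. r \<in> K) (rev ss)"
        using s by (intro filter_cong) auto
      moreover have "set (filter (\<lambda>r. r \<in> K) (rev ss)) \<subseteq> S"
        using S by auto
      ultimately have "coxeter_elt (s # ss) (insert s K) = coxeter_elt ss K \<otimes> s"
        using S by (simp add: coxeter_elt_def)
      then show ?thesis
        using car wpf by (simp add: coxeter_elt_def m_assoc)
    qed
    finally have "(x \<otimes> b) \<otimes> (y \<otimes> q) \<otimes> inv (x \<otimes> b) = coxeter_elt (s # ss) (insert s K) \<otimes> q" .
    moreover have "x \<otimes> b \<in> generate W (set (s # ss))"
      using K 2 GG by (blast intro: generate.eng)
    moreover have "insert s K \<subseteq> set (s # ss)"
      using K by auto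
    ultimately show ?thesis
      by blast
  qed
qed

lemma conj_to_coxeter_elt:
  assumes "path_ordered ss" "set ss = S" "I \<subseteq> S" "w \<in> generate W I"
  obtains K where "K \<subseteq> I" "conj_to w (coxeter_elt ss K)"
proof -
  let ?ss = "filter (\<lambda>s. s \<in> I) ss"
  have set: "set ?ss = I"
    using assms by auto
  obtain K x where K: "K \<subseteq> I" "x \<in> generate W I" "x \<otimes> (w \<otimes> \<one>) \<otimes> inv x = coxeter_elt ?ss K \<otimes> \<one>"
  proof -
    have "\<one> \<otimes> t = t \<otimes> \<one>" if "t \<in> set (tl ?ss)" for t
    proof -
      have "t \<in> set ?ss"
        using that by (rule set_tl)
      then show ?thesis
        using assms(2) by auto
    qed
    then have "\<exists>K\<subseteq>I. \<exists>x\<in>generate W I. x \<otimes> (w \<otimes> \<one>) \<otimes> inv x = coxeter_elt ?ss K \<otimes> \<one>"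
      using conj_to_coxeter_elt_aux[of ?ss w \<one>] path_ordered_filter[OF assms(1)] assms(3,4) unfolding set by blast
    then show ?thesis
      using that by blast
  qed
  have "filter (\<lambda>s. s \<in> K) (rev ?ss) = filter (\<lambda>s. s \<in> K) (rev ss)"
    using K(1) by (auto simp: rev_filter intro!: filter_cong)
  then have "coxeter_elt ?ss K = coxeter_elt ss K"
    by (simp add: coxeter_elt_def)
  moreover have "coxeter_elt ss K \<in> carrier W"
    unfolding coxeter_elt_def using assms by (intro wp_closed) auto
  ultimately have "coxeter_elt ss K = x \<otimes> w \<otimes> inv x"
    using K(3) assms generate_carrier[OF assms(3,4)] generate_carrier[OF assms(3) K(2)] by simp
  then show ?thesis
    using that K generate_carrier[OF assms(3) K(2)] unfolding conj_to_def by blast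
qed

lemma perm_spanI: "(\<lambda>g. \<Sum>I\<in>Pow S. c I * perm_char I g) \<in> perm_span"
  unfolding perm_span_def by (rule rangeI)

lemma perm_span_comb:
  assumes "f \<in> perm_span" "h \<in> perm_span"
  shows "(\<lambda>g. a * f g + b * h g) \<in> perm_span"
proof -
  obtain c d where "f = (\<lambda>g. \<Sum>I\<in>Pow S. c I * perm_char I g)" "h = (\<lambda>g. \<Sum>I\<in>Pow S. d I * perm_char I g)"
    using assms unfolding perm_span_def by blast
  then have "(\<lambda>g. a * f g + b * h g) = (\<lambda>g. \<Sum>I\<in>Pow S. (a * c I + b * d I) * perm_char I g)"
    by (auto simp: sum_distrib_left sum.distrib algebra_simps)
  then show ?thesis
    using perm_spanI[of "\<lambda>I. a * c I + b * d I"] by (simp only:)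
qed

lemma perm_char_in_span:
  assumes "I \<subseteq> S"
  shows "perm_char I \<in> perm_span"
proof -
  have "perm_char I = (\<lambda>g. \<Sum>K\<in>Pow S. (if K = I then 1 else 0) * perm_char K g)"
  proof
    fix g
    have "(\<Sum>K\<in>Pow S. (if K = I then 1 else 0) * perm_char K g) =
        (\<Sum>K\<in>Pow S. if K = I then perm_char K g else 0)"
      by (intro sum.cong) auto
    then show "perm_char I g = (\<Sum>K\<in>Pow S. (if K = I then 1 else 0) * perm_char K g)"
      using assms by simp
  qed
  then show ?thesis
    using perm_spanI[of "\<lambda>K. if K = I then 1 else 0"] by metis
qed

lemma class_functions_comb:
  "f \<in> class_functions W \<Longrightarrow> h \<in> class_functions W \<Longrightarrow> (\<lambda>g. a * f g + b * h g) \<in> class_functions W"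
  by (auto simp: class_functions_def)

lemma class_function_conj_eq:
  assumes "f \<in> class_functions W" "conj_to g h" "g \<in> carrier W"
  shows "f h = f g"
  using assms by (auto simp: class_functions_def conj_to_def)

text \<open>
  Subtracting the right multiple of one class indicator after the other leaves the zero function.
\<close>

lemma class_function_in_span:
  assumes "finite A" "A \<subseteq> carrier W" "\<And>a. a \<in> A \<Longrightarrow> class_ind a \<in> perm_span"
    "f \<in> class_functions W" "\<And>g. f g \<noteq> 0 \<Longrightarrow> \<exists>a\<in>A. conj_to a g"
  shows "f \<in> perm_span"
  using assms
proof (induction A arbitrary: f)
  case empty
  then have "f = (\<lambda>g. 0 * perm_char {} g + 0 * perm_char {} g)"
    by auto
  then show ?case
    using perm_span_comb[OF perm_char_in_span perm_char_in_span, of "{}" "{}" 0 0] by simp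
next
  case (insert a A)
  have a: "a \<in> carrier W"
    using insert by simp
  let ?f = "\<lambda>g. 1 * f g + (- f a) * class_ind a g"
  have "?f \<in> perm_span"
  proof (rule insert.IH)
    show "?f \<in> class_functions W"
      using insert class_ind_class_function[OF a] by (intro class_functions_comb) auto
    fix g
    assume g: "?f g \<noteq> 0"
    then have "\<not> conj_to a g"
      using class_function_conj_eq[OF insert.prems(3) _ a] by (auto simp: class_ind_def)
    then have "f g \<noteq> 0"
      using g by (simp add: class_ind_def)
    then show "\<exists>a\<in>A. conj_to a g"
      using insert.prems(4)[of g] \<open>\<not> conj_to a g\<close> by auto
  qed (use insert in auto)
  then have "(\<lambda>g. 1 * ?f g + f a * class_ind a g) \<in> perm_span"
    using insert.prems(2) by (rule perm_span_comb) simp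
  moreover have "(\<lambda>g. 1 * ?f g + f a * class_ind a g) = f"
    by (simp add: algebra_simps)
  ultimately show ?case
    by simp
qed

lemma coxeter_elt_carrier: "set ss \<subseteq> S \<Longrightarrow> coxeter_elt ss K \<in> carrier W"
  unfolding coxeter_elt_def by (intro wp_closed) auto

lemma perm_char_coxeter_elt_nonzero:
  assumes "set ss = S" "I \<subseteq> S"
  shows "perm_char I (coxeter_elt ss I) \<noteq> 0"
proof -
  let ?g = "coxeter_elt ss I"
  have g: "?g \<in> carrier W" "?g \<in> generate W I"
    unfolding coxeter_elt_def using assms coxeter_elt_carrier by (auto intro!: wp_in_generate wp_closed)
  let ?F = "\<lambda>x. if inv x \<otimes> ?g \<otimes> x \<in> generate W I then 1 else 0 :: rat"
  have "sum ?F {\<one>} \<le> sum ?F (carrier W)"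
    using finite_carrier by (intro sum_mono2) auto
  then have "sum ?F (carrier W) > 0"
    using g by simp
  moreover have "card (generate W I) > 0"
    using finite_generate[OF assms(2)] generate.one[of W I] by (auto simp: card_gt_0_iff)
  ultimately show ?thesis
    using g by (simp add: perm_char_eq)
qed

text \<open>
  Apart from the class of \<open>c_I\<close>, the character of \<open>W_I\<close> is supported on classes of \<open>c_K\<close> with \<open>K \<subset> I\<close>, whose indicators
  are in the span by induction. Its value at \<open>c_I\<close> is nonzero, so the indicator of this class can be solved for.
\<close>

lemma class_ind_coxeter_elt_in_span:
  assumes "path_ordered ss" "set ss = S" "I \<subseteq> S"
  shows "class_ind (coxeter_elt ss I) \<in> perm_span"
  using assms(3)
proof (induction "card I" arbitrary: I rule: less_induct)
  case less
  let ?c = "coxeter_elt ss I" and ?A = "coxeter_elt ss ` {K. K \<subset> I}"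
  have car: "coxeter_elt ss K \<in> carrier W" for K
    using coxeter_elt_carrier assms by simp
  have fin: "finite I"
    using less.prems finite_sub_gens by blast
  let ?v = "perm_char I ?c"
  have v: "?v \<noteq> 0"
    using perm_char_coxeter_elt_nonzero assms less.prems by blast
  let ?f = "\<lambda>g. 1 * perm_char I g + (- ?v) * class_ind ?c g"
  have cl: "perm_char I \<in> class_functions W"
    using perm_char_in_span less.prems perm_span_class by blast
  have "?f \<in> perm_span"
  proof (rule class_function_in_span)
    show "finite ?A"
      using fin by (intro finite_imageI) (auto intro: finite_subset[of _ "Pow I"])
    show "class_ind a \<in> perm_span" if "a \<in> ?A" for a
      using that less.hyps less.prems fin by (auto intro: psubset_card_mono)
    show "?f \<in> class_functions W"
      using cl class_ind_class_function[OF car] by (intro class_functions_comb)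
    fix g
    assume g: "?f g \<noteq> 0"
    then have nc: "\<not> conj_to ?c g"
      using class_function_conj_eq[OF cl _ car] by (auto simp: class_ind_def)
    then have ne: "perm_char I g \<noteq> 0"
      using g by (simp add: class_ind_def)
    then have gc: "g \<in> carrier W"
      unfolding perm_char_def induced_char_def by presburger
    have "\<exists>x\<in>carrier W. inv x \<otimes> g \<otimes> x \<in> generate W I"
    proof (rule ccontr)
      assume "\<not> ?thesis"
      then have "perm_char I g = 0"
        unfolding perm_char_eq[OF gc] by simp
      then show False
        using ne by simp
    qed
    then obtain x where x: "x \<in> carrier W" "inv x \<otimes> g \<otimes> x \<in> generate W I"
      by blast
    then obtain K where K: "K \<subseteq> I" "conj_to (inv x \<otimes> g \<otimes> x) (coxeter_elt ss K)"
      using conj_to_coxeter_elt assms less.prems by blast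
    have "conj_to g (inv x \<otimes> g \<otimes> x)"
      unfolding conj_to_def using x by (intro bexI[of _ "inv x"]) auto
    then have "conj_to (coxeter_elt ss K) g"
      using K gc by (blast intro: conj_to_trans conj_to_sym)
    moreover have "K \<noteq> I"
      using nc calculation by blast
    ultimately show "\<exists>a\<in>?A. conj_to a g"
      using K by blast
  qed (use car in auto)
  then have "(\<lambda>g. (1 / ?v) * perm_char I g + (- 1 / ?v) * ?f g) \<in> perm_span"
    by (rule perm_span_comb[OF perm_char_in_span[OF less.prems]])
  moreover have "(\<lambda>g. (1 / ?v) * perm_char I g + (- 1 / ?v) * ?f g) = class_ind ?c"
    using v by (auto simp: field_simps)
  ultimately show ?case
    by simp
qed

lemma type_A_imp_surjective:
  assumes "product_of_symmetric_groups W S"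
  shows "class_functions W \<subseteq> perm_span"
proof
  fix f
  assume f: "f \<in> class_functions W"
  obtain ss where ss: "path_ordered ss" "set ss = S"
    using path_ordering[OF assms] .
  show "f \<in> perm_span"
  proof (rule class_function_in_span[of "coxeter_elt ss ` Pow S"])
    fix g
    assume "f g \<noteq> 0"
    then have g: "g \<in> carrier W"
      using f by (auto simp: class_functions_def)
    then obtain K where "K \<subseteq> S" "conj_to g (coxeter_elt ss K)"
      using conj_to_coxeter_elt[OF ss order_refl, of g] gens_generate by auto
    then show "\<exists>a\<in>coxeter_elt ss ` Pow S. conj_to a g"
      using conj_to_sym g by blast
  qed (use f ss class_ind_coxeter_elt_in_span coxeter_elt_carrier in auto)
qed

end

theorem corollary2p7:
  fixes W :: "('a, 'b) monoid_scheme" and S :: "'a set"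
  assumes "coxeter_system W S"
    and "finite (carrier W)"
  shows "solomon_hom W S ` descent_algebra W S = class_functions W
    \<longleftrightarrow> product_of_symmetric_groups W S"
proof -
  interpret finite_coxeter_system W S
    using assms by (simp add: finite_coxeter_system_def finite_coxeter_system_axioms_def)
  show ?thesis
    using solomon_hom_image perm_span_class surjective_imp_type_A type_A_imp_surjective by auto
qed

end
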